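(* Let $N,M\ge1$ be integers and let $H_i:\mathbb{R}^N\times\mathbb{R}^N\times\mathbb{R}^M\times\mathbb{R}^N\to\mathbb{R}$, $i=1,\dots,M$, be continuous functions satisfying the structural assumptions (S) stated in the context. For any $i=1,\dots,M$ and any $(x,r,p)\in\mathbb{R}^N\times\mathbb{R}^M\times\mathbb{R}^N$ there exists a unique $\lambda_i=\lambda_i(x,r,p)\in\mathbb{R}$ such that the cell problem $$H_i(x,y,r,p+Dv(y))=\lambda_i,\qquad y\in\mathbb{T}^N,$$ admits a $\mathbb{Z}^N$-periodic viscosity solution $v_i(y)=v_i(y;x,r,p)$ which is Lipschitz continuous. More precisely, for all $R>0$ there exists $L_R>0$ such that $$\sup\{|D_yv_i(\cdot;x,r,p)|_\infty:\ x\in\mathbb{R}^N,\ |r|+|p|\le R\}\le L_R.$$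
   Context: A modulus of continuity is a nondecreasing continuous function $\omega:[0,\infty)\to[0,\infty)$ with $\omega(0)=0$. $BUC$ means bounded and uniformly continuous. $B_N(0,R)$ is the ball of $\mathbb{R}^N$ of center $0$ and radius $R$. $\mathbb{T}^N=[0,1]^N$; functions on $\mathbb{T}^N$ are understood as $\mathbb{Z}^N$-periodic functions on $\mathbb{R}^N$. $|f|_\infty$ is the essential supremum norm over $\mathbb{R}^N$. Assumptions (S), for every $j=1,\dots,M$: (i) $H_j(x,y,r,p)$ is $\mathbb{Z}^N$-periodic in $y$ for any $(x,r,p)$; (ii) $\lim_{|p|\to+\infty}H_j(x,y,r,p)=+\infty$ uniformly in $(x,y,r)$; (iii) for all $R>0$, $H_j\in BUC(\mathbb{R}^N\times\mathbb{R}^N\times[-R,R]^M\times B_N(0,R))$; (iv) there exists a modulus of continuity $\omega$ such that $|H_j(x_1,y_1,r,p)-H_j(x_2,y_2,r,p)|\le\omega\big((1+|p|)(|x_1-x_2|+|y_1-y_2|)\big)$ for every $x_1,x_2,y_1,y_2,p\in\mathbb{R}^N$ and $r\in\mathbb{R}^M$. Viscosity solution of the (scalar, first-order) cell problem is in the standard sense, with $(x,r,p)$ fixed and $y$ the variable. *)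

theory Defs
  imports "HOL-Analysis.Analysis" "HOL-Probability.Essential_Supremum"
begin

definition zn_periodic :: "(real ^ 'n \<Rightarrow> 'b) \<Rightarrow> bool" where
  "zn_periodic f \<longleftrightarrow> (\<forall>y k. (\<forall>j. k $ j \<in> \<int>) \<longrightarrow> f (y + k) = f y)"

text \<open>Only the values of \<open>\<omega>\<close> on the half-line \<open>[0, \<infinity>)\<close> matter; they are nonnegative because
  \<open>\<omega>\<close> is nondecreasing there and vanishes at \<open>0\<close>.\<close>

definition modulus_of_continuity :: "(real \<Rightarrow> real) \<Rightarrow> bool" where
  "modulus_of_continuity \<omega> \<longleftrightarrow> mono_on {0..} \<omega> \<and> continuous_on {0..} \<omega> \<and> \<omega> 0 = 0"

definition BUC_on :: "'a::metric_space set \<Rightarrow> ('a \<Rightarrow> real) \<Rightarrow> bool" where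
  "BUC_on S f \<longleftrightarrow> bounded (f ` S) \<and> uniformly_continuous_on S f"

definition assumptions_S ::
  "(real ^ 'n \<Rightarrow> real ^ 'n \<Rightarrow> real ^ 'm \<Rightarrow> real ^ 'n \<Rightarrow> real) \<Rightarrow> bool" where
  "assumptions_S h \<longleftrightarrow>
     (\<forall>x r p. zn_periodic (\<lambda>y. h x y r p)) \<and>
     (\<forall>C. \<forall>\<^sub>F p in at_infinity. \<forall>x y r. C \<le> h x y r p) \<and>
     (\<forall>R>0. BUC_on (UNIV \<times> UNIV \<times> {r. \<forall>k. r $ k \<in> {-R..R}} \<times> ball 0 R)
                   (\<lambda>(x, y, r, p). h x y r p)) \<and>
     (\<exists>\<omega>. modulus_of_continuity \<omega> \<and>
        (\<forall>x1 x2 y1 y2 p r.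
           \<bar>h x1 y1 r p - h x2 y2 r p\<bar>
             \<le> \<omega> ((1 + norm p) * (norm (x1 - x2) + norm (y1 - y2)))))"

text \<open>Continuous viscosity sub- and supersolutions on the whole space of the first-order equation
  \<open>F (y, D u (y)) = 0\<close>, tested with \<open>C\<^sup>1\<close> functions \<open>\<phi>\<close> (with gradient \<open>D\<phi>\<close>) at the points
  \<open>y\<close> where \<open>u - \<phi>\<close> has a local maximum, respectively a local minimum.\<close>

definition viscosity_subsolution ::
  "('a::euclidean_space \<Rightarrow> 'a \<Rightarrow> real) \<Rightarrow> ('a \<Rightarrow> real) \<Rightarrow> bool" where
  "viscosity_subsolution F u \<longleftrightarrow> continuous_on UNIV u \<and>
     (\<forall>\<phi> D\<phi> y. (\<forall>z. GDERIV \<phi> z :> D\<phi> z) \<longrightarrow> continuous_on UNIV D\<phi> \<longrightarrow>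
        (\<forall>\<^sub>F z in nhds y. u z - \<phi> z \<le> u y - \<phi> y) \<longrightarrow> F y (D\<phi> y) \<le> 0)"

definition viscosity_supersolution ::
  "('a::euclidean_space \<Rightarrow> 'a \<Rightarrow> real) \<Rightarrow> ('a \<Rightarrow> real) \<Rightarrow> bool" where
  "viscosity_supersolution F u \<longleftrightarrow> continuous_on UNIV u \<and>
     (\<forall>\<phi> D\<phi> y. (\<forall>z. GDERIV \<phi> z :> D\<phi> z) \<longrightarrow> continuous_on UNIV D\<phi> \<longrightarrow>
        (\<forall>\<^sub>F z in nhds y. u y - \<phi> y \<le> u z - \<phi> z) \<longrightarrow> 0 \<le> F y (D\<phi> y))"

definition viscosity_solution ::
  "('a::euclidean_space \<Rightarrow> 'a \<Rightarrow> real) \<Rightarrow> ('a \<Rightarrow> real) \<Rightarrow> bool" where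
  "viscosity_solution F u \<longleftrightarrow> viscosity_subsolution F u \<and> viscosity_supersolution F u"

definition lipschitz_cell_solution ::
  "(real ^ 'n \<Rightarrow> real ^ 'n \<Rightarrow> real ^ 'm \<Rightarrow> real ^ 'n \<Rightarrow> real) \<Rightarrow>
   real ^ 'n \<Rightarrow> real ^ 'm \<Rightarrow> real ^ 'n \<Rightarrow> real \<Rightarrow> (real ^ 'n \<Rightarrow> real) \<Rightarrow> bool" where
  "lipschitz_cell_solution h x r p l v \<longleftrightarrow>
     zn_periodic v \<and> (\<exists>C. C-lipschitz_on UNIV v) \<and>
     viscosity_solution (\<lambda>y q. h x y r (p + q) - l) v"

text \<open>The gradient of a Lipschitz function exists almost everywhere (Rademacher), so the value
  \<open>0\<close> chosen at the remaining points does not affect an essential supremum.\<close>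

definition gradient :: "('a::euclidean_space \<Rightarrow> real) \<Rightarrow> 'a \<Rightarrow> 'a" where
  "gradient v y = (if \<exists>D. GDERIV v y :> D then THE D. GDERIV v y :> D else 0)"

definition ess_sup_norm :: "('a::euclidean_space \<Rightarrow> 'b::real_normed_vector) \<Rightarrow> ereal" where
  "ess_sup_norm f = esssup lebesgue (\<lambda>y. ereal (norm (f y)))"

end

theory Submission
  imports Defs "HOL-Complex_Analysis.Great_Picard"
begin

text \<open>Coercivity makes every bounded subsolution Lipschitz, with a constant depending only on the
  size of the Hamiltonian at \<open>q = 0\<close>. Hence Perron's method for the discounted equation
  \<open>d u + G (y, Du) = 0\<close> can be run inside a class of equi-Lipschitz functions, where the supremum is
  continuous and no comparison principle is needed. Letting \<open>d\<close> tend to \<open>0\<close>, the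
  functions \<open>u - u 0\<close> and the constants \<open>- d u 0\<close> converge along a subsequence by
  Arzela-Ascoli, and the limits solve the cell problem. Doubling the variables in two Lipschitz
  solutions gives uniqueness of the constant. The Lipschitz estimate holds for every solution, since
  testing at a minimum bounds the constant; so any choice of the correctors is admissible.\<close>

section \<open>Test functions and local extrema\<close>

text \<open>In this encoding \<open>F\<close> sees only \<open>y\<close> and \<open>q\<close>, not
  the value of the unknown. The discounted term \<open>d * w y\<close> is therefore frozen into
  \<open>F\<close>, and each competitor \<open>w\<close> satisfies an inequality with its own
  \<open>F\<close>. This shapes \<open>viscosity_subsolution_stable\<close>, where the equation may
  vary along with the function. That lemma serves both the Perron supremum and the limit of
  vanishing discount; supersolutions reach it by reflecting \<open>u\<close> to \<open>- u\<close>
  and \<open>q\<close> to \<open>- q\<close>. Two numbers run through the proof. \<open>C\<close>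
  bounds the Hamiltonian at \<open>q = 0\<close>, which makes \<open>- C / d\<close> and
  \<open>C / d\<close> barriers; \<open>K\<close> bounds the sublevel set at height \<open>C\<close>
  and becomes the Lipschitz constant. Neither depends on \<open>d\<close>, whence compactness, and
  both are uniform for |r| + |p| \<le> R, whence L_R.\<close>

lemma GDERIV_quadratic:
  "GDERIV (\<lambda>z. c * ((z - a) \<bullet> (z - a))) z :> (2 * c) *\<^sub>R (z - a)"
  unfolding gderiv_def
  by (auto intro!: derivative_eq_intros simp: fun_eq_iff inner_commute algebra_simps inner_diff_right)

lemma GDERIV_local_max_unique:
  assumes "GDERIV f z :> a" "GDERIV g z :> b" "\<forall>\<^sub>F x in nhds z. f x - g x \<le> f z - g z"
  shows "a = b"
proof -
  obtain S where S: "open S" "z \<in> S" "\<And>x. x \<in> S \<Longrightarrow> f x - g x \<le> f z - g z"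
    using assms(3) unfolding eventually_nhds by blast
  have "((\<lambda>x. f x - g x) has_derivative (\<lambda>h. h \<bullet> (a - b))) (at z)"
    using GDERIV_diff[OF assms(1,2)] unfolding gderiv_def .
  then have "(\<lambda>h. h \<bullet> (a - b)) = (\<lambda>h. 0)"
    using differential_zero_maxmin[OF S(2,1)] S(3) by blast
  then have "(a - b) \<bullet> (a - b) = 0" by metis
  then show ?thesis by simp
qed

text \<open>A strict maximum survives small perturbations, with nearby contact point and gradient.
  Closeness of \<open>w'\<close> to \<open>w\<close> is one-sided: from above everywhere, from below
  only at \<open>y\<close>. This suits a competitor that nearly attains a supremum at a single
  point.\<close>

lemma touching_perturbation:
  fixes w :: "'a::euclidean_space \<Rightarrow> real"
  assumes \<phi>: "\<And>z. GDERIV \<phi> z :> D\<phi> z" and D\<phi>: "continuous_on UNIV D\<phi>"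
    and max: "\<forall>\<^sub>F z in nhds y. w z - \<phi> z \<le> w y - \<phi> y" and "0 < \<eta>"
  obtains \<epsilon> where "0 < \<epsilon>"
    "\<And>w'. \<lbrakk>continuous_on UNIV w'; \<And>z. w' z \<le> w z + \<epsilon>; w y - \<epsilon> \<le> w' y\<rbrakk> \<Longrightarrow>
       \<exists>\<psi> D\<psi> z. (\<forall>x. GDERIV \<psi> x :> D\<psi> x) \<and> continuous_on UNIV D\<psi> \<and>
         (\<forall>\<^sub>F x in nhds z. w' x - \<psi> x \<le> w' z - \<psi> z) \<and> dist z y < \<eta> \<and> dist (D\<psi> z) (D\<phi> y) < \<eta>"
proof -
  \<comment> \<open>The added square makes the maximum strict without changing the gradient at
    \<open>y\<close>.\<close>
  define \<psi> where "\<psi> = (\<lambda>z. \<phi> z + 1 * ((z - y) \<bullet> (z - y)))"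
  define D\<psi> where "D\<psi> = (\<lambda>z. D\<phi> z + (2 * 1) *\<^sub>R (z - y))"
  have \<psi>: "GDERIV \<psi> z :> D\<psi> z" for z
    unfolding \<psi>_def D\<psi>_def by (intro GDERIV_add \<phi> GDERIV_quadratic)
  have c\<psi>: "continuous_on UNIV \<psi>"
    using \<psi> unfolding gderiv_def
    by (meson continuous_at_imp_continuous_on has_derivative_continuous)
  have D\<psi>: "continuous_on UNIV D\<psi>"
    unfolding D\<psi>_def by (intro continuous_intros D\<phi>)
  obtain a where a: "0 < a" "\<And>z. dist z y < a \<Longrightarrow> w z - \<phi> z \<le> w y - \<phi> y"
    using max unfolding eventually_nhds_metric by blast
  obtain b where b: "0 < b" "\<And>z. dist z y < b \<Longrightarrow> dist (D\<psi> z) (D\<psi> y) < \<eta>"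
    using D\<psi> \<open>0 < \<eta>\<close> by (metis UNIV_I continuous_on_iff)
  define \<rho> where "\<rho> = Min {a, b, \<eta>} / 2"
  have \<rho>: "0 < \<rho>" "\<rho> < a" "\<rho> < b" "\<rho> < \<eta>"
    using a b \<open>0 < \<eta>\<close> by (auto simp: \<rho>_def min_def)
  \<comment> \<open>The maximiser \<open>z\<close> over the closed ball will satisfy |z - y|^2 \<le>
    2 \<epsilon>, which is below \<rho>^2. Hence \<open>z\<close> is interior and the maximum is a
    local one in the whole space.\<close>
  define \<epsilon> where "\<epsilon> = \<rho>\<^sup>2 / 3"
  show thesis
  proof (rule that[of \<epsilon>])
    show "0 < \<epsilon>" using \<rho> by (simp add: \<epsilon>_def)
    fix w' assume w': "continuous_on UNIV w'" "\<And>z. w' z \<le> w z + \<epsilon>" "w y - \<epsilon> \<le> w' y"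
    have "continuous_on (cball y \<rho>) (\<lambda>x. w' x - \<psi> x)"
      by (intro continuous_intros continuous_on_subset[OF w'(1)] continuous_on_subset[OF c\<psi>]) auto
    then obtain z where z: "z \<in> cball y \<rho>" "\<And>x. x \<in> cball y \<rho> \<Longrightarrow> w' x - \<psi> x \<le> w' z - \<psi> z"
      using continuous_attains_sup[of "cball y \<rho>" "\<lambda>x. w' x - \<psi> x"] \<rho> by auto
    have "w' y - \<phi> y \<le> w' z - \<psi> z"
      using z(2)[of y] \<rho> by (simp add: \<psi>_def)
    moreover have "w z - \<phi> z \<le> w y - \<phi> y"
      using z(1) \<rho> by (intro a) (simp add: dist_commute)
    ultimately have "(dist z y)\<^sup>2 \<le> 2 * \<epsilon>"
      using w'(2)[of z] w'(3) by (simp add: \<psi>_def dist_norm power2_norm_eq_inner)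
    also have "\<dots> < \<rho>\<^sup>2" using \<rho> by (simp add: \<epsilon>_def)
    finally have "dist z y < \<rho>"
      using \<rho> by (meson less_imp_le power_less_imp_less_base)
    then have "z \<in> ball y \<rho>" by (simp add: dist_commute)
    then have "\<forall>\<^sub>F x in nhds z. x \<in> ball y \<rho>"
      by (intro eventually_nhds_in_open) auto
    then have "\<forall>\<^sub>F x in nhds z. w' x - \<psi> x \<le> w' z - \<psi> z"
      by eventually_elim (simp add: z(2))
    moreover have "dist (D\<psi> z) (D\<phi> y) < \<eta>"
      using b(2)[of z] \<open>dist z y < \<rho>\<close> \<rho> by (simp add: D\<psi>_def)
    moreover have "dist z y < \<eta>" using \<open>dist z y < \<rho>\<close> \<rho> by simp
    ultimately show "\<exists>\<psi> D\<psi> z. (\<forall>x. GDERIV \<psi> x :> D\<psi> x) \<and> continuous_on UNIV D\<psi> \<and>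
         (\<forall>\<^sub>F x in nhds z. w' x - \<psi> x \<le> w' z - \<psi> z) \<and> dist z y < \<eta> \<and> dist (D\<psi> z) (D\<phi> y) < \<eta>"
      using \<psi> D\<psi> by blast
  qed
qed

section \<open>Viscosity subsolutions\<close>

lemma viscosity_subsolutionD:
  assumes "viscosity_subsolution F u" "\<And>z. GDERIV \<phi> z :> D\<phi> z" "continuous_on UNIV D\<phi>"
    "\<forall>\<^sub>F z in nhds y. u z - \<phi> z \<le> u y - \<phi> y"
  shows "F y (D\<phi> y) \<le> 0"
  using assms unfolding viscosity_subsolution_def by blast

lemma viscosity_supersolutionD:
  assumes "viscosity_supersolution F u" "\<And>z. GDERIV \<phi> z :> D\<phi> z" "continuous_on UNIV D\<phi>"
    "\<forall>\<^sub>F z in nhds y. u y - \<phi> y \<le> u z - \<phi> z"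
  shows "0 \<le> F y (D\<phi> y)"
  using assms unfolding viscosity_supersolution_def by blast

lemma viscosity_supersolution_iff:
  "viscosity_supersolution F u \<longleftrightarrow> viscosity_subsolution (\<lambda>y q. - F y (- q)) (\<lambda>y. - u y)"
    (is "?L \<longleftrightarrow> ?R")
proof
  assume L: ?L
  show ?R unfolding viscosity_subsolution_def
  proof (intro conjI allI impI)
    show "continuous_on UNIV (\<lambda>y. - u y)"
      using L unfolding viscosity_supersolution_def by (intro continuous_on_minus) blast
    fix \<phi> D\<phi> y
    assume *: "\<forall>z. GDERIV \<phi> z :> D\<phi> z" "continuous_on UNIV D\<phi>"
      "\<forall>\<^sub>F z in nhds y. - u z - \<phi> z \<le> - u y - \<phi> y"
    have "0 \<le> F y (- D\<phi> y)"
      by (rule viscosity_supersolutionD[OF L, of "\<lambda>z. - \<phi> z" "\<lambda>z. - D\<phi> z"])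
        (use * in \<open>auto intro: GDERIV_minus continuous_on_minus elim: eventually_mono\<close>)
    then show "- F y (- D\<phi> y) \<le> 0" by simp
  qed
next
  assume R: ?R
  show ?L unfolding viscosity_supersolution_def
  proof (intro conjI allI impI)
    have "continuous_on UNIV (\<lambda>y. - (- u y))"
      using R unfolding viscosity_subsolution_def by (rule_tac continuous_on_minus) blast
    then show "continuous_on UNIV u" by simp
    fix \<phi> D\<phi> y
    assume *: "\<forall>z. GDERIV \<phi> z :> D\<phi> z" "continuous_on UNIV D\<phi>"
      "\<forall>\<^sub>F z in nhds y. u y - \<phi> y \<le> u z - \<phi> z"
    have "- F y (- (- D\<phi> y)) \<le> 0"
      by (rule viscosity_subsolutionD[OF R, of "\<lambda>z. - \<phi> z" "\<lambda>z. - D\<phi> z"])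
        (use * in \<open>auto intro: GDERIV_minus continuous_on_minus elim: eventually_mono\<close>)
    then show "0 \<le> F y (D\<phi> y)" by simp
  qed
qed

text \<open>The contact points of the approximants tend to \<open>y\<close>, so an error
  \<open>C * (e + dist z y)\<close> between the two equations disappears in the limit. The distance
  term absorbs the variation of zero-order terms that agree up to \<open>e\<close> only at
  \<open>y\<close>.\<close>

lemma viscosity_subsolution_stable:
  assumes F: "continuous_on UNIV (\<lambda>(y, q). F y q)" and w: "continuous_on UNIV w" and "0 \<le> C"
    and approx: "\<And>y e. 0 < e \<Longrightarrow> \<exists>w' F'. viscosity_subsolution F' w' \<and> (\<forall>z. w' z \<le> w z + e) \<and>
      w y - e \<le> w' y \<and> (\<forall>z q. F z q \<le> F' z q + C * (e + dist z y))"
  shows "viscosity_subsolution F w"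
  unfolding viscosity_subsolution_def
proof (intro conjI w allI impI)
  fix \<phi> D\<phi> y
  assume \<phi>: "\<forall>z. GDERIV \<phi> z :> D\<phi> z" "continuous_on UNIV D\<phi>"
    "\<forall>\<^sub>F z in nhds y. w z - \<phi> z \<le> w y - \<phi> y"
  show "F y (D\<phi> y) \<le> 0"
  proof (rule ccontr)
    define m where "m = F y (D\<phi> y) / 2"
    assume "\<not> ?thesis"
    then have "0 < m" by (simp add: m_def)
    obtain d where d: "0 < d" "\<And>x. dist x (y, D\<phi> y) < d \<Longrightarrow> dist (case x of (z, q) \<Rightarrow> F z q) (F y (D\<phi> y)) < m"
      using F \<open>0 < m\<close> unfolding continuous_on_iff by fastforce
    \<comment> \<open>The first bound keeps the perturbed point and gradient where continuity gives
      \<open>F > m\<close>; the second keeps the error, at most \<open>C * (2 * \<eta>)\<close>,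
      below \<open>m\<close>.\<close>
    define \<eta> where "\<eta> = min (d / 2) (m / (4 * (C + 1)))"
    have \<eta>: "0 < \<eta>" using d \<open>0 < m\<close> \<open>0 \<le> C\<close> by (simp add: \<eta>_def)
    obtain \<epsilon> where \<epsilon>: "0 < \<epsilon>" "\<And>w'. \<lbrakk>continuous_on UNIV w'; \<And>z. w' z \<le> w z + \<epsilon>; w y - \<epsilon> \<le> w' y\<rbrakk> \<Longrightarrow>
       \<exists>\<psi> D\<psi> z. (\<forall>x. GDERIV \<psi> x :> D\<psi> x) \<and> continuous_on UNIV D\<psi> \<and>
         (\<forall>\<^sub>F x in nhds z. w' x - \<psi> x \<le> w' z - \<psi> z) \<and> dist z y < \<eta> \<and> dist (D\<psi> z) (D\<phi> y) < \<eta>"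
      by (rule touching_perturbation[OF \<phi>(1)[rule_format] \<phi>(2,3) \<eta>]) blast
    define e where "e = min \<epsilon> \<eta>"
    have e: "0 < e" "e \<le> \<epsilon>" "e \<le> \<eta>" using \<epsilon> \<eta> by (auto simp: e_def)
    obtain w' F' where w': "viscosity_subsolution F' w'" "\<And>z. w' z \<le> w z + e" "w y - e \<le> w' y"
      "\<And>z q. F z q \<le> F' z q + C * (e + dist z y)"
      using approx[OF e(1)] by blast
    have "\<And>z. w' z \<le> w z + \<epsilon>" "w y - \<epsilon> \<le> w' y"
      using w'(2,3) e by (force intro: order_trans)+
    then obtain \<psi> D\<psi> z where \<psi>: "\<forall>x. GDERIV \<psi> x :> D\<psi> x" "continuous_on UNIV D\<psi>"
      "\<forall>\<^sub>F x in nhds z. w' x - \<psi> x \<le> w' z - \<psi> z" "dist z y < \<eta>" "dist (D\<psi> z) (D\<phi> y) < \<eta>"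
      using \<epsilon>(2)[of w'] w'(1) unfolding viscosity_subsolution_def by blast
    have "F' z (D\<psi> z) \<le> 0"
      using viscosity_subsolutionD[OF w'(1) _ \<psi>(2,3)] \<psi>(1) by blast
    moreover have "C * (e + dist z y) \<le> C * (2 * \<eta>)"
      using e \<psi>(4) \<open>0 \<le> C\<close> by (intro mult_left_mono) auto
    moreover have "(C + 1) * \<eta> \<le> m / 4"
    proof -
      have "\<eta> \<le> m / (4 * (C + 1))" by (simp add: \<eta>_def)
      then show ?thesis using \<open>0 \<le> C\<close> by (simp add: field_simps)
    qed
    ultimately have "F z (D\<psi> z) \<le> m"
      using w'(4)[of z "D\<psi> z"] \<eta> \<open>0 < m\<close> by (simp add: algebra_simps)
    moreover have "dist (z, D\<psi> z) (y, D\<phi> y) < d"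
    proof -
      have "dist (z, D\<psi> z) (y, D\<phi> y) \<le> dist z y + dist (D\<psi> z) (D\<phi> y)"
        by (simp add: dist_Pair_Pair sqrt_sum_squares_le_sum)
      also have "\<dots> < 2 * \<eta>" using \<psi> by simp
      also have "\<dots> \<le> d" by (simp add: \<eta>_def)
      finally show ?thesis .
    qed
    then have "F z (D\<psi> z) > m"
      using d(2)[of "(z, D\<psi> z)"] by (auto simp: m_def dist_real_def abs_if split: if_splits)
    ultimately show False by simp
  qed
qed

lemma continuous_attains_sup_compact_superlevel:
  fixes f :: "'a::topological_space \<Rightarrow> real"
  assumes "compact S" "continuous_on S f" "x0 \<in> S" "\<And>x. x \<notin> S \<Longrightarrow> f x \<le> f x0"
  obtains z where "\<And>x. f x \<le> f z"
proof -
  obtain z where "z \<in> S" "\<And>x. x \<in> S \<Longrightarrow> f x \<le> f z"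
    using continuous_attains_sup[OF assms(1) _ assms(2)] assms(3) by blast
  then have "f x \<le> f z" for x
    using assms(3) assms(4)[of x] by (cases "x \<in> S") (auto intro: order_trans)
  then show ?thesis using that by blast
qed

text \<open>The cone \<^term>\<open>L * norm (z - x)\<close> is touched from above at any point \<^term>\<open>z \<noteq> x\<close> by the
  paraboloid obtained from the tangent of the concave square root.\<close>

lemma viscosity_subsolution_lipschitz:
  fixes u :: "'a::euclidean_space \<Rightarrow> real"
  assumes sub: "viscosity_subsolution F u" and bdd: "\<And>y. \<bar>u y\<bar> \<le> B"
    and F: "\<And>y q. F y q \<le> 0 \<Longrightarrow> norm q \<le> K" and "0 \<le> K"
  shows "K-lipschitz_on UNIV u"
proof -
  have cu: "continuous_on UNIV u" using sub by (simp add: viscosity_subsolution_def)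
  have "0 \<le> B" using bdd[of 0] by simp
  have lip': "u z \<le> u x + L * norm (z - x)" if "K < L" for x z L
  proof -
    have "0 < L" using that \<open>0 \<le> K\<close> by simp
    define f where "f z = u z - L * norm (z - x)" for z
    \<comment> \<open>Outside this ball the cone exceeds the oscillation \<open>2 * B\<close> of
      \<open>u\<close>, so a global maximum exists although the domain is unbounded.\<close>
    have "continuous_on (cball x (2 * B / L)) f"
      unfolding f_def by (intro continuous_intros continuous_on_subset[OF cu]) auto
    moreover have "f z \<le> f x" if "z \<notin> cball x (2 * B / L)" for z
    proof -
      have "2 * B < L * norm (z - x)"
        using that \<open>0 < L\<close> by (simp add: dist_norm norm_minus_commute field_simps)
      then show ?thesis using bdd[of z] bdd[of x] by (simp add: f_def abs_le_iff)
    qed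
    ultimately obtain z' where z': "\<And>z. f z \<le> f z'"
      using continuous_attains_sup_compact_superlevel[of "cball x (2 * B / L)" f x] \<open>0 \<le> B\<close> \<open>0 < L\<close> by auto
    \<comment> \<open>Away from its vertex the cone has a gradient of length \<open>L > K\<close>,
      which \<open>F\<close> excludes. A maximum at the vertex is exactly the one-sided Lipschitz
      bound.\<close>
    have "z' = x"
    proof (rule ccontr)
      assume "z' \<noteq> x"
      define d where "d = norm (z' - x)"
      have "0 < d" using \<open>z' \<noteq> x\<close> by (simp add: d_def)
      define \<phi> where "\<phi> z = L / (2 * d) * ((z - x) \<bullet> (z - x)) + L * d / 2" for z
      have \<phi>: "GDERIV \<phi> z :> (2 * (L / (2 * d))) *\<^sub>R (z - x) + 0" for z
        unfolding \<phi>_def by (intro GDERIV_add GDERIV_quadratic GDERIV_const)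
      have "L * norm (z - x) \<le> \<phi> z" for z
      proof -
        have "0 \<le> L / (2 * d) * (norm (z - x) - d)\<^sup>2"
          using \<open>0 < L\<close> \<open>0 < d\<close> by simp
        also have "\<dots> = \<phi> z - L * norm (z - x)"
          using \<open>0 < d\<close> unfolding \<phi>_def power2_norm_eq_inner[symmetric]
          by (simp add: field_simps power2_eq_square)
        finally show ?thesis by simp
      qed
      moreover have "\<phi> z' = L * norm (z' - x)"
        using \<open>0 < d\<close> unfolding \<phi>_def power2_norm_eq_inner[symmetric] d_def
        by (simp add: field_simps power2_eq_square)
      ultimately have "u z - \<phi> z \<le> u z' - \<phi> z'" for z
        using z'[of z] unfolding f_def by (smt (verit))
      then have "F z' ((2 * (L / (2 * d))) *\<^sub>R (z' - x) + 0) \<le> 0"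
        by (intro viscosity_subsolutionD[OF sub \<phi>]) (auto intro!: continuous_intros)
      then have "norm ((2 * (L / (2 * d))) *\<^sub>R (z' - x) + 0) \<le> K" by (rule F)
      then show False using \<open>K < L\<close> \<open>0 < L\<close> \<open>0 < d\<close> by (simp add: d_def)
    qed
    then show ?thesis using z'[of z] by (simp add: f_def)
  qed
  have lip: "u z \<le> u x + K * norm (z - x)" for x z
  proof (rule field_le_epsilon)
    fix e :: real assume "0 < e"
    define L where "L = K + e / (norm (z - x) + 1)"
    have "K < L" using \<open>0 < e\<close> by (simp add: L_def add_nonneg_pos)
    have "u z \<le> u x + L * norm (z - x)" by (rule lip'[OF \<open>K < L\<close>])
    also have "\<dots> \<le> u x + K * norm (z - x) + e"
    proof -
      have "e / (norm (z - x) + 1) * norm (z - x) \<le> e"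
        using \<open>0 < e\<close> by (simp add: divide_le_eq add_nonneg_pos mult_left_mono)
      then show ?thesis by (simp add: L_def algebra_simps)
    qed
    finally show "u z \<le> u x + K * norm (z - x) + e" .
  qed
  show ?thesis
  proof (rule lipschitz_onI[OF _ \<open>0 \<le> K\<close>])
    fix x y show "dist (u x) (u y) \<le> K * dist x y"
      using lip[of x y] lip[of y x] by (simp add: dist_norm abs_le_iff norm_minus_commute)
  qed
qed

section \<open>Perron's method for the discounted equation\<close>

lemma zn_periodic_add: "zn_periodic f \<Longrightarrow> (\<And>j. k $ j \<in> \<int>) \<Longrightarrow> f (y + k) = f y"
  by (simp add: zn_periodic_def)

lemma viscosity_subsolution_translate:
  fixes u :: "'a::euclidean_space \<Rightarrow> real"
  assumes "viscosity_subsolution F u" "\<And>y q. F (y + k) q = F' y q"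
  shows "viscosity_subsolution F' (\<lambda>y. u (y + k))"
  unfolding viscosity_subsolution_def
proof (intro conjI allI impI)
  show "continuous_on UNIV (\<lambda>y. u (y + k))"
  proof -
    have "continuous_on UNIV u" using assms(1) by (simp add: viscosity_subsolution_def)
    then show ?thesis by (rule continuous_on_compose2) (auto intro!: continuous_intros)
  qed
  fix \<phi> D\<phi> y
  assume *: "\<forall>z. GDERIV \<phi> z :> D\<phi> z" "continuous_on UNIV D\<phi>"
      "\<forall>\<^sub>F z in nhds y. u (z + k) - \<phi> z \<le> u (y + k) - \<phi> y"
  have "F (y + k) (D\<phi> (y + k - k)) \<le> 0"
  proof (rule viscosity_subsolutionD[OF assms(1), of "\<lambda>z. \<phi> (z - k)" "\<lambda>z. D\<phi> (z - k)"])
    fix z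
    have "((\<lambda>z. z - k) has_derivative (\<lambda>h. h)) (at z)"
      by (auto intro!: derivative_eq_intros)
    from has_derivative_compose[OF this *(1)[rule_format, unfolded gderiv_def]]
    show "GDERIV (\<lambda>z. \<phi> (z - k)) z :> D\<phi> (z - k)"
      unfolding gderiv_def .
  next
    show "continuous_on UNIV (\<lambda>z. D\<phi> (z - k))"
      by (rule continuous_on_compose2[OF *(2)]) (auto intro!: continuous_intros)
    have "((\<lambda>z. z - k) \<longlongrightarrow> y + k - k) (nhds (y + k))"
      by (intro tendsto_diff filterlim_ident tendsto_const)
    then have "filterlim (\<lambda>z. z - k) (nhds y) (nhds (y + k))" by simp
    then have "\<forall>\<^sub>F z in nhds (y + k). u (z - k + k) - \<phi> (z - k) \<le> u (y + k) - \<phi> y"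
      by (rule eventually_compose_filterlim[OF *(3)])
    then show "\<forall>\<^sub>F z in nhds (y + k). u z - \<phi> (z - k) \<le> u (y + k) - \<phi> (y + k - k)"
      by simp
  qed
  then show "F' y (D\<phi> y) \<le> 0" by (simp add: assms(2))
qed

text \<open>Competitors in Perron's method. The two-sided bound is part of the class because it is
  what makes the class equi-Lipschitz.\<close>

definition discounted_class :: "real \<Rightarrow> real \<Rightarrow> ('a::euclidean_space \<Rightarrow> 'a \<Rightarrow> real) \<Rightarrow> ('a \<Rightarrow> real) set" where
  "discounted_class d C G =
     {w. (\<forall>y. \<bar>d * w y\<bar> \<le> C) \<and> viscosity_subsolution (\<lambda>y q. d * w y + G y q) w}"

text \<open>Since \<open>- d * w y \<le> C\<close>, the discounted inequality implies
  \<open>G y q \<le> C\<close>, whatever \<open>d\<close> is.\<close>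

lemma discounted_class_lipschitz:
  assumes w: "w \<in> discounted_class d C G" and "0 < d"
    and K: "\<forall>y q. G y q \<le> C \<longrightarrow> norm q \<le> K" "0 \<le> K"
  shows "K-lipschitz_on UNIV w"
proof (rule viscosity_subsolution_lipschitz)
  show "viscosity_subsolution (\<lambda>y q. d * w y + G y q) w"
    using w by (simp add: discounted_class_def)
  show "\<bar>w y\<bar> \<le> C / d" for y
    using w \<open>0 < d\<close> by (simp add: discounted_class_def abs_mult field_simps)
  show "norm q \<le> K" if "d * w y + G y q \<le> 0" for y q
    using that w by (intro K(1)[rule_format, of y]) (auto simp: discounted_class_def abs_le_iff dest!: spec[of _ y])
  show "0 \<le> K" by fact
qed

lemma discounted_class_Sup:
  fixes G :: "'a::euclidean_space \<Rightarrow> 'a \<Rightarrow> real"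
  assumes G: "continuous_on UNIV (\<lambda>(y, q). G y q)" and bound: "\<And>y. \<bar>G y 0\<bar> \<le> C"
    and K: "\<forall>y q. G y q \<le> C \<longrightarrow> norm q \<le> K" and "0 < d"
  defines "u y \<equiv> SUP w\<in>discounted_class d C G. w y"
  shows "u \<in> discounted_class d C G" "\<And>w y. w \<in> discounted_class d C G \<Longrightarrow> w y \<le> u y"
proof -
  let ?S = "discounted_class d C G"
  have C: "0 \<le> C" using bound[of 0] by simp
  have K0: "0 \<le> K" using K[rule_format, of 0 0] bound[of 0] by simp
  \<comment> \<open>The lower barrier makes the class nonempty: a function touching a constant has
    gradient 0 there, and \<open>G y 0 \<le> C\<close>.\<close>
  have "viscosity_subsolution (\<lambda>y q. d * (- C / d) + G y q) (\<lambda>y. - C / d)"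
    unfolding viscosity_subsolution_def
  proof (intro conjI allI impI)
    fix \<phi> and D\<phi> :: "'a \<Rightarrow> 'a" and y
    assume *: "\<forall>z. GDERIV \<phi> z :> D\<phi> z" "\<forall>\<^sub>F z in nhds y. - C / d - \<phi> z \<le> - C / d - \<phi> y"
    have "0 = D\<phi> y"
      by (rule GDERIV_local_max_unique[OF GDERIV_const *(1)[rule_format] *(2)])
    then show "d * (- C / d) + G y (D\<phi> y) \<le> 0"
      using bound[of y] \<open>0 < d\<close> by (simp add: abs_le_iff)
  qed auto
  then have ne: "(\<lambda>y. - C / d) \<in> ?S"
    using \<open>0 < d\<close> C by (simp add: discounted_class_def)
  then have ne0: "?S \<noteq> {}" by blast
  have bounds: "w y \<le> C / d" "- C / d \<le> w y" if "w \<in> ?S" for w y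
    using that \<open>0 < d\<close> by (auto simp: discounted_class_def abs_le_iff field_simps dest!: spec[of _ y])
  have bdd: "bdd_above ((\<lambda>w. w y) ` ?S)" for y
    using bounds(1) by (intro bdd_aboveI[of _ "C / d"]) auto
  show upper: "w y \<le> u y" if "w \<in> ?S" for w y
    unfolding u_def by (rule cSUP_upper[OF that bdd])
  have near: "\<exists>w\<in>?S. u y - e < w y" if "0 < e" for y e
    using that less_cSUP_iff[OF ne0 bdd[of y], of "u y - e"] by (simp add: u_def)
  have ub: "u y \<le> C / d" "- C / d \<le> u y" for y
    using bounds(1) ne upper[OF ne, of y] unfolding u_def by (auto intro!: cSUP_least)
  have lip: "w z \<le> w y + K * dist z y" if "w \<in> ?S" for w y z
    using lipschitz_onD[OF discounted_class_lipschitz[OF that \<open>0 < d\<close> K K0], of z y]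
    by (simp add: dist_real_def abs_le_iff)
  have lip_u: "u z \<le> u y + K * dist z y" for y z
  proof -
    have "w z \<le> u y + K * dist z y" if "w \<in> ?S" for w
      using lip[OF that, of z y] upper[OF that, of y] by simp
    then show ?thesis unfolding u_def[of z] using ne0 by (intro cSUP_least) auto
  qed
  have "K-lipschitz_on UNIV u"
  proof (rule lipschitz_onI[OF _ K0])
    show "dist (u y) (u z) \<le> K * dist y z" for y z
      using lip_u[of y z] lip_u[of z y] by (simp add: dist_real_def abs_le_iff dist_commute)
  qed
  then have cu: "continuous_on UNIV u" by (rule lipschitz_on_continuous_on)
  have "viscosity_subsolution (\<lambda>y q. d * u y + G y q) u"
  \<comment> \<open>A near-optimal \<open>w\<close> at \<open>y\<close> satisfies
    \<open>u - w \<le> e\<close> there. As both are \<open>K\<close>-Lipschitz, the gap grows at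
    most by \<open>2 * K * dist z y\<close>, and the equation multiplies it by
    \<open>d\<close>.\<close>
  proof (rule viscosity_subsolution_stable[where C = "d * (2 * K + 1)"])
    have "continuous_on UNIV (\<lambda>x. d * u (fst x) + (case x of (y, q) \<Rightarrow> G y q))"
      by (intro continuous_intros G continuous_on_compose2[OF cu]) auto
    then show "continuous_on UNIV (\<lambda>(y, q). d * u y + G y q)"
      by (simp add: case_prod_unfold)
    show "0 \<le> d * (2 * K + 1)" using \<open>0 < d\<close> K0 by simp
    fix y :: 'a and e :: real assume "0 < e"
    then obtain w where w: "w \<in> ?S" "u y - e < w y" using near by blast
    have "d * u z + G z q \<le> d * w z + G z q + d * (2 * K + 1) * (e + dist z y)" for z q
    proof -
      have "u z \<le> w z + 2 * K * dist z y + e"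
        using lip_u[of z y] lip[OF w(1), of y z] w(2) by (simp add: dist_commute)
      also have "\<dots> \<le> w z + (2 * K + 1) * (e + dist z y)"
        using K0 \<open>0 < e\<close> by (simp add: algebra_simps)
      finally have "d * u z \<le> d * (w z + (2 * K + 1) * (e + dist z y))"
        using \<open>0 < d\<close> by (intro mult_left_mono) auto
      then show ?thesis by (simp add: algebra_simps)
    qed
    then show "\<exists>w' F'. viscosity_subsolution F' w' \<and> (\<forall>z. w' z \<le> u z + e) \<and> u y - e \<le> w' y \<and>
        (\<forall>z q. d * u z + G z q \<le> F' z q + d * (2 * K + 1) * (e + dist z y))"
      using w upper[OF w(1)] \<open>0 < e\<close>
      by (intro exI[of _ w] exI[of _ "\<lambda>y q. d * w y + G y q"])
        (auto simp: discounted_class_def add_increasing2)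
  qed (rule cu)
  then show "u \<in> ?S"
    using ub \<open>0 < d\<close> by (auto simp: discounted_class_def abs_le_iff field_simps minus_le_iff)
qed

text \<open>Where the supersolution inequality fails, the test function touching from below is a
  strict classical subsolution nearby. Lifting it slightly and taking the maximum with
  \<open>u\<close> gives a strictly larger member, so the Perron supremum must be a
  supersolution.\<close>

lemma discounted_class_bump:
  fixes G :: "'a::euclidean_space \<Rightarrow> 'a \<Rightarrow> real"
  assumes G: "continuous_on UNIV (\<lambda>(y, q). G y q)" and bound: "\<And>y. \<bar>G y 0\<bar> \<le> C" and "0 < d"
    and u: "u \<in> discounted_class d C G"
    and not_super: "\<not> viscosity_supersolution (\<lambda>y q. d * u y + G y q) u"
  obtains w y where "w \<in> discounted_class d C G" "u y < w y"
proof -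
  have sub: "viscosity_subsolution (\<lambda>y q. d * u y + G y q) u" and ub: "\<And>y. \<bar>d * u y\<bar> \<le> C"
    using u by (auto simp: discounted_class_def)
  have cu: "continuous_on UNIV u" using sub by (simp add: viscosity_subsolution_def)
  obtain \<phi>0 D\<phi>0 y where \<phi>0: "\<And>z. GDERIV \<phi>0 z :> D\<phi>0 z" "continuous_on UNIV D\<phi>0"
    "\<forall>\<^sub>F z in nhds y. u y - \<phi>0 y \<le> u z - \<phi>0 z" "d * u y + G y (D\<phi>0 y) < 0"
    using not_super cu unfolding viscosity_supersolution_def not_le[symmetric] by blast
  \<comment> \<open>Normalised so that \<open>\<phi> y = u y\<close> and
    \<open>u z - \<phi> z\<close> is at least |z - y|^2 near \<open>y\<close>.\<close>
  define \<phi> where "\<phi> z = \<phi>0 z + ((-1) * ((z - y) \<bullet> (z - y)) + (u y - \<phi>0 y))" for z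
  define D\<phi> where "D\<phi> z = D\<phi>0 z + ((2 * (-1)) *\<^sub>R (z - y) + 0)" for z
  have \<phi>: "GDERIV \<phi> z :> D\<phi> z" for z
    unfolding \<phi>_def D\<phi>_def by (intro GDERIV_add \<phi>0 GDERIV_quadratic GDERIV_const)
  have D\<phi>: "continuous_on UNIV D\<phi>"
    unfolding D\<phi>_def by (intro continuous_intros \<phi>0)
  have c\<phi>: "continuous_on UNIV \<phi>"
    using \<phi> unfolding gderiv_def
    by (meson continuous_at_imp_continuous_on has_derivative_continuous)
  have \<phi>y: "\<phi> y = u y" "D\<phi> y = D\<phi>0 y" by (auto simp: \<phi>_def D\<phi>_def)
  \<comment> \<open>The bump stays below the barrier \<open>C / d\<close>: where \<open>u\<close> attains it, the test function has
    gradient \<open>0\<close>, and the bound on \<open>G\<close> forces the supersolution inequality.\<close>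
  have lt: "d * u y < C"
  proof (rule ccontr)
    assume "\<not> d * u y < C"
    then have eq: "d * u y = C" using ub[of y] by (simp add: abs_le_iff)
    have "d * u z \<le> d * u y" for z using ub[of z] eq by (simp add: abs_le_iff)
    then have max: "u z \<le> u y" for z using \<open>0 < d\<close> by simp
    have "\<forall>\<^sub>F z in nhds y. \<phi>0 z - 0 \<le> \<phi>0 y - 0"
      using \<phi>0(3) by eventually_elim (use max in smt)
    then have "D\<phi>0 y = 0"
      by (rule GDERIV_local_max_unique[OF \<phi>0(1) GDERIV_const])
    then show False using \<phi>0(4) eq bound[of y] by (simp add: abs_le_iff)
  qed
  obtain a where a: "0 < a" "\<And>z. dist z y < a \<Longrightarrow> u y - \<phi>0 y \<le> u z - \<phi>0 z"
    using \<phi>0(3) unfolding eventually_nhds_metric by blast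
  have "continuous_on UNIV (\<lambda>z. d * \<phi> z + (case (z, D\<phi> z) of (y, q) \<Rightarrow> G y q))"
    by (intro continuous_intros c\<phi> continuous_on_compose2[OF G] D\<phi>) auto
  then have cE: "continuous_on UNIV (\<lambda>z. d * \<phi> z + G z (D\<phi> z))" by simp
  \<comment> \<open>Half of the smaller of two slacks: in the strict inequality and below the
    barrier. One \<open>m\<close> pays for the variation over the small ball, another for the lift
    \<open>d * \<kappa>\<close>.\<close>
  define m where "m = min (- (d * u y + G y (D\<phi>0 y))) (C - d * u y) / 2"
  have m: "0 < m" "2 * m \<le> - (d * u y + G y (D\<phi>0 y))" "2 * m \<le> C - d * u y"
    using lt \<phi>0(4) by (auto simp: m_def)
  obtain b where b: "0 < b"
      "\<And>z. dist z y < b \<Longrightarrow> dist (d * \<phi> z + G z (D\<phi> z)) (d * \<phi> y + G y (D\<phi> y)) < m"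
    using cE[unfolded continuous_on_iff, rule_format, of y m] m(1) by auto
  obtain c where c: "0 < c" "\<And>z. dist z y < c \<Longrightarrow> dist (d * \<phi> z) (d * \<phi> y) < m"
    using continuous_on_mult[OF continuous_on_const[of _ d] c\<phi>,
      unfolded continuous_on_iff, rule_format, of y m] m(1) by auto
  define \<rho> where "\<rho> = Min {a, b, c} / 2"
  have \<rho>: "0 < \<rho>" "\<rho> < a" "\<rho> < b" "\<rho> < c"
    using a b c by (auto simp: \<rho>_def min_def)
  \<comment> \<open>Being below \<rho>^2 / 4, the lift is already beaten by the quadratic gap at
    distance \<rho> / 2. Both branches of \<open>w\<close> thus agree on an annulus, so the gluing
    is continuous.\<close>
  define \<kappa> where "\<kappa> = min (m / d) (\<rho>\<^sup>2 / 8)"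
  have \<kappa>: "0 < \<kappa>" "d * \<kappa> \<le> m" "\<kappa> < \<rho>\<^sup>2 / 4"
    using \<rho>(1) \<open>0 < m\<close> \<open>0 < d\<close> by (auto simp: \<kappa>_def min_def field_simps)
  define w where "w z = (if dist z y < \<rho> then max (u z) (\<phi> z + \<kappa>) else u z)" for z
  have ge: "u z \<le> w z" for z by (simp add: w_def)
  have outer: "w z = u z" if "\<rho> / 2 \<le> dist z y" for z
  proof (cases "dist z y < \<rho>")
    case True
    have "(\<rho> / 2)\<^sup>2 \<le> (dist z y)\<^sup>2" using that \<rho> by (intro power_mono) auto
    then have "\<rho>\<^sup>2 / 4 \<le> (z - y) \<bullet> (z - y)"
      by (simp add: dist_norm power2_norm_eq_inner power_divide)
    then have "\<phi> z + \<kappa> \<le> u z" using a(2)[of z] True \<rho> \<kappa> by (simp add: \<phi>_def)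
    then show ?thesis by (simp add: w_def)
  qed (simp add: w_def)
  have ev_in: "\<forall>\<^sub>F x in nhds z. w x = max (u x) (\<phi> x + \<kappa>)" if "dist z y < \<rho>" for z
  proof -
    have "\<forall>\<^sub>F x in nhds z. x \<in> ball y \<rho>"
      using that by (intro eventually_nhds_in_open) (auto simp: dist_commute)
    then show ?thesis by eventually_elim (simp add: w_def dist_commute)
  qed
  have ev_out: "\<forall>\<^sub>F x in nhds z. w x = u x" if "\<not> dist z y < \<rho>" for z
  proof -
    have "\<forall>\<^sub>F x in nhds z. x \<in> - cball y (\<rho> / 2)"
      using that \<rho> by (intro eventually_nhds_in_open) (auto simp: dist_commute)
    then show ?thesis by eventually_elim (simp add: outer dist_commute)
  qed
  have cw: "continuous_on UNIV w"
    unfolding continuous_on_eq_continuous_at[OF open_UNIV]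
  proof
    fix z
    have cm: "isCont (\<lambda>x. max (u x) (\<phi> x + \<kappa>)) z"
      using cu c\<phi> by (intro continuous_intros) (auto simp: continuous_on_eq_continuous_at)
    have "isCont u z" using cu by (auto simp: continuous_on_eq_continuous_at)
    then show "isCont w z"
      using cm isCont_cong[OF ev_in] isCont_cong[OF ev_out] by (cases "dist z y < \<rho>") auto
  qed
  have small: "d * \<phi> z + d * \<kappa> \<le> C" "d * (\<phi> z + \<kappa>) + G z (D\<phi> z) \<le> 0" if "dist z y < \<rho>" for z
    using b(2)[of z] c(2)[of z] that \<rho> m \<kappa> \<phi>y
    by (auto simp: dist_real_def abs_less_iff algebra_simps)
  have "\<bar>d * w z\<bar> \<le> C" for z
  proof -
    have "d * w z \<le> C"
      using small(1)[of z] ub[of z] by (auto simp: w_def max_def abs_le_iff algebra_simps)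
    moreover have "d * u z \<le> d * w z" using ge \<open>0 < d\<close> by simp
    ultimately show ?thesis using ub[of z] by (simp add: abs_le_iff)
  qed
  moreover have "viscosity_subsolution (\<lambda>y q. d * w y + G y q) w"
    unfolding viscosity_subsolution_def
  proof (intro conjI cw allI impI)
    fix \<psi> D\<psi> z
    assume \<psi>: "\<forall>x. GDERIV \<psi> x :> D\<psi> x" "continuous_on UNIV D\<psi>"
      "\<forall>\<^sub>F x in nhds z. w x - \<psi> x \<le> w z - \<psi> z"
    show "d * w z + G z (D\<psi> z) \<le> 0"
    \<comment> \<open>If \<open>w\<close> meets \<open>u\<close>, then \<psi> also touches
      \<open>u\<close> from above. Otherwise it touches \<open>\<phi> + \<kappa>\<close>, and the
      gradients coincide.\<close>
    proof (cases "w z = u z")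
      case True
      have "\<forall>\<^sub>F x in nhds z. u x - \<psi> x \<le> u z - \<psi> z"
        using \<psi>(3) by eventually_elim (use ge True in \<open>smt (verit)\<close>)
      then show ?thesis
        using viscosity_subsolutionD[OF sub _ \<psi>(2)] \<psi>(1) True by metis
    next
      case False
      then have z: "dist z y < \<rho>" "w z = \<phi> z + \<kappa>" by (auto simp: w_def max_def split: if_splits)
      have "\<forall>\<^sub>F x in nhds z. \<phi> x - \<psi> x \<le> \<phi> z - \<psi> z"
        using \<psi>(3) ev_in[OF z(1)] by eventually_elim (use z in auto)
      then have "D\<phi> z = D\<psi> z"
        by (rule GDERIV_local_max_unique[OF \<phi> \<psi>(1)[rule_format]])
      then show ?thesis using small(2)[OF z(1)] z(2) by simp
    qed
  qed
  ultimately have "w \<in> discounted_class d C G" by (simp add: discounted_class_def)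
  moreover have "u y < w y" using \<rho> \<kappa> \<phi>y by (simp add: w_def)
  ultimately show thesis by (rule that)
qed

text \<open>The competitors in Perron's method need not be periodic; the supremum is periodic because
  the class is invariant under integer translations.\<close>

lemma discounted_solution:
  fixes G :: "real ^ 'n \<Rightarrow> real ^ 'n \<Rightarrow> real"
  assumes G: "continuous_on UNIV (\<lambda>(y, q). G y q)" and per: "\<And>q. zn_periodic (\<lambda>y. G y q)"
    and bound: "\<And>y. \<bar>G y 0\<bar> \<le> C" and K: "\<forall>y q. G y q \<le> C \<longrightarrow> norm q \<le> K" and "0 < d"
  obtains u where "zn_periodic u" "K-lipschitz_on UNIV u" "\<And>y. \<bar>d * u y\<bar> \<le> C"
    "viscosity_solution (\<lambda>y q. d * u y + G y q) u"
proof -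
  let ?S = "discounted_class d C G"
  define u where "u y = (SUP w\<in>?S. w y)" for y
  have u: "u \<in> ?S" and upper: "\<And>w y. w \<in> ?S \<Longrightarrow> w y \<le> u y"
    using discounted_class_Sup[OF G bound K \<open>0 < d\<close>] unfolding u_def by blast+
  have K0: "0 \<le> K" using K[rule_format, of 0 0] bound[of 0] by simp
  have "(\<lambda>y. w (y + k)) \<in> ?S" if "w \<in> ?S" "\<forall>j. k $ j \<in> \<int>" for w k
    using that zn_periodic_add[OF per, of k]
    by (auto simp: discounted_class_def intro!: viscosity_subsolution_translate)
  then have le: "u (y + k) \<le> u y" if "\<forall>j. k $ j \<in> \<int>" for y k
    using upper[of "\<lambda>y. u (y + k)"] u that by blast
  have "u (y + k) = u y" if "\<forall>j. k $ j \<in> \<int>" for y k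
    using le[of k y] le[of "- k" "y + k"] that by simp
  then have "zn_periodic u" by (simp add: zn_periodic_def)
  moreover have "viscosity_supersolution (\<lambda>y q. d * u y + G y q) u"
    proof (rule ccontr)
    assume "\<not> ?thesis"
    from discounted_class_bump[OF G bound \<open>0 < d\<close> u this]
    show False using upper by (metis not_le)
  qed
  ultimately have "viscosity_solution (\<lambda>y q. d * u y + G y q) u" "zn_periodic u"
    using u by (simp_all add: discounted_class_def viscosity_solution_def)
  moreover have "\<bar>d * u y\<bar> \<le> C" for y using u by (simp add: discounted_class_def)
  ultimately show thesis
    using that discounted_class_lipschitz[OF u \<open>0 < d\<close> K K0] by blast
qed

section \<open>The cell problem\<close>

lemma integer_translate_into_cube:
  fixes y :: "real ^ 'n"
  obtains k where "\<forall>j. k $ j \<in> \<int>" "y + k \<in> cbox 0 1"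
proof -
  define k :: "real ^ 'n" where "k = (\<chi> j. - of_int \<lfloor>y $ j\<rfloor>)"
  have "0 \<le> y $ j + k $ j \<and> y $ j + k $ j \<le> 1" for j
    unfolding k_def by (simp, linarith)
  then show ?thesis
    by (intro that[of k]) (auto simp: mem_box_cart k_def)
qed

lemma zn_periodic_cube:
  assumes "zn_periodic f"
  obtains y' where "y' \<in> cbox 0 1" "f y' = f y"
proof -
  obtain k where k: "\<forall>j. k $ j \<in> \<int>" "y + k \<in> cbox 0 1"
    using integer_translate_into_cube by blast
  show ?thesis
    using that[OF k(2)] zn_periodic_add[OF assms, of k y] k(1) by simp
qed

lemma zn_periodic_continuous_bounded:
  fixes v :: "real ^ 'n \<Rightarrow> real"
  assumes "zn_periodic v" "continuous_on UNIV v"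
  obtains B where "\<And>y. \<bar>v y\<bar> \<le> B"
proof -
  have "compact (v ` cbox 0 1)"
    by (intro compact_continuous_image continuous_on_subset[OF assms(2)]) auto
  then obtain B where B: "\<forall>x\<in>v ` cbox 0 1. norm x \<le> B"
    using compact_imp_bounded[of "v ` cbox 0 1"] unfolding bounded_iff by blast
  have "\<bar>v y\<bar> \<le> B" for y
    by (rule zn_periodic_cube[OF assms(1), of y]) (use B in force)
  then show ?thesis by (rule that)
qed

lemma zn_periodic_continuous_attains_inf:
  fixes v :: "real ^ 'n \<Rightarrow> real"
  assumes "zn_periodic v" "continuous_on UNIV v"
  obtains y0 where "\<And>y. v y0 \<le> v y"
proof -
  have "0 \<in> cbox 0 (1 :: real ^ 'n)" by (simp add: mem_box_cart)
  then obtain y0 where y0: "\<forall>y\<in>cbox 0 1. v y0 \<le> v y"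
    using continuous_attains_inf[OF compact_cbox _ continuous_on_subset[OF assms(2) subset_UNIV]]
    by blast
  have "v y0 \<le> v y" for y
    by (rule zn_periodic_cube[OF assms(1), of y]) (use y0 in force)
  then show ?thesis by (rule that)
qed

lemma viscosity_subsolution_add_const:
  "viscosity_subsolution F u \<Longrightarrow> viscosity_subsolution F (\<lambda>y. u y + c)"
proof -
  assume "viscosity_subsolution F u"
  moreover have "u z + c - \<phi> z \<le> u y + c - \<phi> y \<longleftrightarrow> u z - \<phi> z \<le> u y - \<phi> y" for \<phi> y z by simp
  ultimately show ?thesis
    unfolding viscosity_subsolution_def by (auto intro: continuous_on_add continuous_on_const)
qed

text \<open>Testing with a constant at a minimum of \<^term>\<open>v\<close> shows \<^term>\<open>l \<le> C\<close>.\<close>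

lemma cell_solution_lipschitz:
  fixes G :: "real ^ 'n \<Rightarrow> real ^ 'n \<Rightarrow> real"
  assumes bound: "\<And>y. \<bar>G y 0\<bar> \<le> C" and K: "\<forall>y q. G y q \<le> C \<longrightarrow> norm q \<le> K"
    and per: "zn_periodic v" and v: "viscosity_solution (\<lambda>y q. G y q - l) v"
  shows "K-lipschitz_on UNIV v"
proof -
  have sub: "viscosity_subsolution (\<lambda>y q. G y q - l) v"
    and super: "viscosity_supersolution (\<lambda>y q. G y q - l) v"
    using v by (auto simp: viscosity_solution_def)
  have cv: "continuous_on UNIV v" using sub by (simp add: viscosity_subsolution_def)
  obtain B where B: "\<And>y. \<bar>v y\<bar> \<le> B"
    using zn_periodic_continuous_bounded[OF per cv] by blast
  obtain y0 where y0: "\<And>y. v y0 \<le> v y"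
    using zn_periodic_continuous_attains_inf[OF per cv] by blast
  have "0 \<le> G y0 0 - l"
    by (rule viscosity_supersolutionD[OF super, of "\<lambda>_. 0" "\<lambda>_. 0"])
      (use y0 in \<open>auto intro: GDERIV_const\<close>)
  then have "l \<le> C" using bound[of y0] by simp
  have "0 \<le> K" using K[rule_format, of 0 0] bound[of 0] by simp
  show ?thesis
  proof (rule viscosity_subsolution_lipschitz[OF sub B _ \<open>0 \<le> K\<close>])
    fix y q assume "G y q - l \<le> 0"
    then show "norm q \<le> K" using K[rule_format, of y q] \<open>l \<le> C\<close> by simp
  qed
qed

text \<open>The zero-order term becomes a constant because \<open>d n * u n y\<close> differs from
  \<open>- l n\<close> by \<open>d n * v n y\<close>, and \<open>v n\<close> is bounded uniformly in
  \<open>n\<close> by periodicity and the common Lipschitz constant.\<close>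

lemma cell_solution_exists:
  fixes G :: "real ^ 'n \<Rightarrow> real ^ 'n \<Rightarrow> real"
  assumes G: "continuous_on UNIV (\<lambda>(y, q). G y q)" and per: "\<And>q. zn_periodic (\<lambda>y. G y q)"
    and bound: "\<And>y. \<bar>G y 0\<bar> \<le> C" and K: "\<forall>y q. G y q \<le> C \<longrightarrow> norm q \<le> K"
  obtains l v where "zn_periodic v" "K-lipschitz_on UNIV v"
    "viscosity_solution (\<lambda>y q. G y q - l) v"
proof -
  define d where "d n = 1 / real (Suc n)" for n
  have d0: "0 < d n" for n by (simp add: d_def)
  have "\<forall>n. \<exists>u. zn_periodic u \<and> K-lipschitz_on UNIV u \<and> (\<forall>y. \<bar>d n * u y\<bar> \<le> C) \<and>
      viscosity_solution (\<lambda>y q. d n * u y + G y q) u"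
    using discounted_solution[OF G per bound K d0] by blast
  from choice[OF this] obtain u where u: "\<And>n. zn_periodic (u n)"
    "\<And>n. K-lipschitz_on UNIV (u n)" "\<And>n y. \<bar>d n * u n y\<bar> \<le> C"
    "\<And>n. viscosity_solution (\<lambda>y q. d n * u n y + G y q) (u n)"
    by blast
  have K0: "0 \<le> K" using lipschitz_on_nonneg[OF u(2)[of 0]] .
  obtain B where B: "\<And>y. y \<in> cbox 0 (1 :: real ^ 'n) \<Longrightarrow> norm y \<le> B"
    using bounded_cbox[of 0 "1 :: real ^ 'n"] unfolding bounded_iff by blast
  define v where "v n y = u n y - u n 0" for n y
  have vper: "zn_periodic (v n)" for n using u(1)[of n] by (simp add: v_def zn_periodic_def)
  have vlip: "\<bar>v n y - v n z\<bar> \<le> K * dist y z" for n y z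
    using lipschitz_onD[OF u(2)[of n], of y z] by (simp add: v_def dist_real_def)
  have vcube: "\<bar>v n y\<bar> \<le> K * B" if "y \<in> cbox 0 1" for n y
    using vlip[of n y 0] mult_left_mono[OF B[OF that] K0] by (simp add: v_def)
  have vbound: "\<bar>v n y\<bar> \<le> K * B" for n y
    by (rule zn_periodic_cube[OF vper[of n], of y]) (use vcube in metis)
  define l where "l n = - (d n * u n 0)" for n
  have "\<forall>n. l n \<in> {- C..C}" using u(3)[of _ 0] by (auto simp: l_def abs_le_iff minus_le_iff)
  then obtain l0 r1 where r1: "strict_mono r1" "(l \<circ> r1) \<longlonglongrightarrow> l0"
    using compact_imp_seq_compact[OF compact_Icc, of "- C" C] unfolding seq_compact_def by blast
  obtain g k where g: "strict_mono (k :: nat \<Rightarrow> nat)"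
    "\<And>e. 0 < e \<Longrightarrow> \<exists>N. \<forall>n x. N \<le> n \<and> x \<in> cbox 0 1 \<longrightarrow> norm (v (r1 (k n)) x - g x) < e"
  proof (rule Arzela_Ascoli[of "cbox 0 (1 :: real ^ 'n)" "\<lambda>n. v (r1 n)" "K * B"])
    fix x :: "real ^ 'n" and e :: real assume "0 < e"
    have "\<bar>v (r1 n) x - v (r1 n) y\<bar> < e" if "norm (x - y) < e / (K + 1)" for n y
    proof -
      have "\<bar>v (r1 n) x - v (r1 n) y\<bar> \<le> K * norm (x - y)" using vlip by (simp add: dist_norm)
      also have "\<dots> \<le> (K + 1) * norm (x - y)" by (simp add: algebra_simps)
      also have "\<dots> < e" using that K0 by (simp add: field_simps)
      finally show ?thesis .
    qed
    then show "\<exists>\<delta>>0. \<forall>n y. y \<in> cbox 0 1 \<and> norm (x - y) < \<delta> \<longrightarrow>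
        norm (v (r1 n) x - v (r1 n) y) < e"
      using \<open>0 < e\<close> K0 by (intro exI[of _ "e / (K + 1)"]) auto
  qed (use vcube in auto)
  define s where "s = r1 \<circ> k"
  have s: "strict_mono s" unfolding s_def using r1(1) g(1) by (rule strict_mono_o)
  have ls: "(\<lambda>n. l (s n)) \<longlonglongrightarrow> l0"
    using LIMSEQ_subseq_LIMSEQ[OF r1(2) g(1)] by (simp add: s_def o_def)
  have ds: "(\<lambda>n. d (s n) * (K * B)) \<longlonglongrightarrow> 0 * (K * B)"
    using LIMSEQ_subseq_LIMSEQ[OF LIMSEQ_inverse_real_of_nat s]
    by (intro tendsto_mult tendsto_const) (simp add: d_def o_def inverse_eq_divide)
  \<comment> \<open>The limit \<open>g\<close> is controlled only on the unit cube. By periodicity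
    the sequence at any point equals the sequence at a translate in the cube, so the pointwise limit
    extends \<open>g\<close> and convergence is uniform on the whole space.\<close>
  define v0 where "v0 y = lim (\<lambda>n. v (s n) y)" for y
  have unif: "\<exists>N. \<forall>n\<ge>N. \<forall>y. \<bar>v (s n) y - v0 y\<bar> < e" if "0 < e" for e
  proof -
    have lim: "(\<lambda>n. v (s n) y) \<longlonglongrightarrow> g y" if "y \<in> cbox 0 1" for y
      using g(2) that unfolding s_def LIMSEQ_iff by (metis o_apply)
    have "\<exists>y'\<in>cbox 0 1. v0 y = g y' \<and> (\<forall>n. v (s n) y = v (s n) y')" for y
    proof -
      obtain k where k: "\<forall>j. k $ j \<in> \<int>" "y + k \<in> cbox 0 1"
        using integer_translate_into_cube by blast
      have "v (s n) y = v (s n) (y + k)" for n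
        using zn_periodic_add[OF vper, of k] k(1) by simp
      then show ?thesis using lim[OF k(2)] k(2)
        by (intro bexI[of _ "y + k"]) (auto simp: v0_def limI)
    qed
    then show ?thesis
      using g(2)[OF that] unfolding s_def by (metis o_apply real_norm_def)
  qed
  have v0: "(\<lambda>n. v (s n) y) \<longlonglongrightarrow> v0 y" for y
    using unif unfolding LIMSEQ_iff by (metis real_norm_def)
  have "zn_periodic v0"
    unfolding v0_def zn_periodic_def using zn_periodic_add[OF vper] by simp
  moreover have lip: "K-lipschitz_on UNIV v0"
  proof (rule lipschitz_onI[OF _ K0])
    fix y z
    have "(\<lambda>n. dist (v (s n) y) (v (s n) z)) \<longlonglongrightarrow> dist (v0 y) (v0 z)"
      by (intro tendsto_dist v0)
    then show "dist (v0 y) (v0 z) \<le> K * dist y z"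
      by (rule LIMSEQ_le_const2) (use vlip in \<open>auto simp: dist_real_def\<close>)
  qed
  have approx: "\<exists>n. (\<forall>y. \<bar>v n y - v0 y\<bar> < e) \<and> (\<forall>y. \<bar>d n * u n y + l0\<bar> < e)" if e: "0 < e" for e
  proof -
    obtain N1 where N1: "\<forall>n\<ge>N1. \<forall>y. \<bar>v (s n) y - v0 y\<bar> < e" using unif[OF e] by blast
    obtain N2 where N2: "\<forall>n\<ge>N2. \<bar>l (s n) - l0\<bar> < e / 2"
      using ls e unfolding LIMSEQ_iff real_norm_def by (meson half_gt_zero)
    obtain N3 where N3: "\<forall>n\<ge>N3. \<bar>d (s n) * (K * B) - 0 * (K * B)\<bar> < e / 2"
      using ds e unfolding LIMSEQ_iff real_norm_def by (meson half_gt_zero)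
    define n where "n = s (max N1 (max N2 N3))"
    have n: "\<forall>y. \<bar>v n y - v0 y\<bar> < e" "\<bar>l n - l0\<bar> < e / 2" "\<bar>d n * (K * B)\<bar> < e / 2"
      using N1 N2 N3 by (auto simp: n_def)
    have "\<bar>d n * u n y + l0\<bar> < e" for y
    proof -
      have "\<bar>d n * v n y\<bar> \<le> d n * (K * B)"
        using vbound[of n y] d0[of n] by (simp add: abs_mult)
      moreover have "d n * u n y + l0 = d n * v n y - (l n - l0)"
        by (simp add: v_def l_def algebra_simps)
      ultimately show ?thesis using n(2,3) by arith
    qed
    then show ?thesis using n(1) by blast
  qed
  have cv0: "continuous_on UNIV v0" using lip by (rule lipschitz_on_continuous_on)
  have vsub: "viscosity_subsolution (\<lambda>y q. d n * u n y + G y q) (v n)" for n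
    using viscosity_subsolution_add_const[of _ "u n" "- u n 0"] u(4)[of n]
    by (simp add: viscosity_solution_def v_def[abs_def])
  have vsuper: "viscosity_subsolution (\<lambda>y q. - (d n * u n y + G y (- q))) (\<lambda>y. - v n y)" for n
    using viscosity_subsolution_add_const[of _ "\<lambda>y. - u n y" "u n 0"] u(4)[of n]
    by (simp add: viscosity_solution_def viscosity_supersolution_iff v_def[abs_def])
  have "viscosity_subsolution (\<lambda>y q. G y q - l0) v0"
  proof (rule viscosity_subsolution_stable[where C = 1])
    have "continuous_on UNIV (\<lambda>x. (case x of (y, q) \<Rightarrow> G y q) - l0)"
      by (intro continuous_intros G)
    then show "continuous_on UNIV (\<lambda>(y, q). G y q - l0)" by (simp add: case_prod_unfold)
    fix y :: "real ^ 'n" and e :: real assume "0 < e"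
    obtain n where n: "\<forall>y. \<bar>v n y - v0 y\<bar> < e" "\<forall>y. \<bar>d n * u n y + l0\<bar> < e"
      using approx[OF \<open>0 < e\<close>] by blast
    have "v n z \<le> v0 z + e" "v0 z - e \<le> v n z" for z using n(1)[rule_format, of z] by auto
    moreover have "G z q - l0 \<le> d n * u n z + G z q + 1 * (e + dist z y)" for z q
    proof -
      have "- l0 \<le> d n * u n z + e" using n(2)[rule_format, of z] by (auto simp: abs_less_iff)
      also have "\<dots> \<le> d n * u n z + (e + dist z y)" by simp
      finally show ?thesis by simp
    qed
    ultimately show "\<exists>w' F'. viscosity_subsolution F' w' \<and> (\<forall>z. w' z \<le> v0 z + e) \<and>
        v0 y - e \<le> w' y \<and> (\<forall>z q. G z q - l0 \<le> F' z q + 1 * (e + dist z y))"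
      using vsub[of n] by blast
  qed (use cv0 in auto)
  moreover have "viscosity_subsolution (\<lambda>y q. - (G y (- q) - l0)) (\<lambda>y. - v0 y)"
  proof (rule viscosity_subsolution_stable[where C = 1])
    have "continuous_on UNIV (\<lambda>x. - ((case (fst x, - snd x) of (y, q) \<Rightarrow> G y q) - l0))"
      by (intro continuous_intros continuous_on_compose2[OF G]) auto
    then show "continuous_on UNIV (\<lambda>(y, q). - (G y (- q) - l0))" by (simp add: case_prod_unfold)
    show "continuous_on UNIV (\<lambda>y. - v0 y)" using cv0 by (rule continuous_on_minus)
    fix y :: "real ^ 'n" and e :: real assume "0 < e"
    obtain n where n: "\<forall>y. \<bar>v n y - v0 y\<bar> < e" "\<forall>y. \<bar>d n * u n y + l0\<bar> < e"
      using approx[OF \<open>0 < e\<close>] by blast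
    have "- v n z \<le> - v0 z + e" "- v0 z - e \<le> - v n z" for z using n(1)[rule_format, of z] by auto
    moreover have "- (G z (- q) - l0) \<le> - (d n * u n z + G z (- q)) + 1 * (e + dist z y)" for z q
    proof -
      have "l0 \<le> - (d n * u n z) + e" using n(2)[rule_format, of z] by (auto simp: abs_less_iff)
      also have "\<dots> \<le> - (d n * u n z) + (e + dist z y)" by simp
      finally show ?thesis by simp
    qed
    ultimately show "\<exists>w' F'. viscosity_subsolution F' w' \<and> (\<forall>z. w' z \<le> - v0 z + e) \<and>
        - v0 y - e \<le> w' y \<and> (\<forall>z q. - (G z (- q) - l0) \<le> F' z q + 1 * (e + dist z y))"
      using vsuper[of n] by (intro exI[of _ "\<lambda>y. - v n y"] exI conjI allI)
  qed simp
  ultimately show thesis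
    using that[of v0 l0] lip by (simp add: viscosity_solution_def viscosity_supersolution_iff)
qed

text \<open>Doubling of variables with one fixed penalty parameter: at the maximum (a, b) both
  equations are tested with the same \<open>q\<close>, so
  \<open>l2 \<le> G b q < G a q + e \<le> l1 + e\<close>.\<close>

lemma cell_comparison:
  fixes G :: "real ^ 'n \<Rightarrow> real ^ 'n \<Rightarrow> real"
  assumes unif: "\<And>R e. 0 < e \<Longrightarrow>
      \<exists>\<delta>>0. \<forall>y z q. norm q \<le> R \<longrightarrow> norm (y - z) < \<delta> \<longrightarrow> \<bar>G y q - G z q\<bar> < e"
    and per: "zn_periodic v1" "zn_periodic v2" and lip: "L-lipschitz_on UNIV v1"
    and sub: "viscosity_subsolution (\<lambda>y q. G y q - l1) v1"
    and super: "viscosity_supersolution (\<lambda>y q. G y q - l2) v2"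
  shows "l2 \<le> l1"
proof (rule field_le_epsilon)
  fix e :: real assume "0 < e"
  obtain \<delta> where \<delta>: "0 < \<delta>" "\<And>y z q. norm q \<le> 2 * L \<Longrightarrow> norm (y - z) < \<delta> \<Longrightarrow> \<bar>G y q - G z q\<bar> < e"
    using unif[OF \<open>0 < e\<close>, of "2 * L"] by blast
  have L: "0 \<le> L" using lip by (rule lipschitz_on_nonneg)
  \<comment> \<open>The maximum will give \<open>c * norm (a - b) \<le> L\<close>. This bounds
    \<open>q\<close> by \<open>2 * L\<close> independently of \<open>c\<close>, so \<delta> can be
    fixed first and \<open>c\<close> then taken large enough for
    \<open>norm (a - b) < \<delta>\<close>.\<close>
  define c where "c = (L + 1) / \<delta>"
  have c: "0 < c" using L \<delta> by (simp add: c_def)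
  have cv: "continuous_on UNIV v1" "continuous_on UNIV v2"
    using sub super by (auto simp: viscosity_subsolution_def viscosity_supersolution_def)
  obtain B1 where B1: "\<And>y. \<bar>v1 y\<bar> \<le> B1"
    using zn_periodic_continuous_bounded[OF per(1) cv(1)] by blast
  obtain B2 where B2: "\<And>y. \<bar>v2 y\<bar> \<le> B2"
    using zn_periodic_continuous_bounded[OF per(2) cv(2)] by blast
  obtain N where N: "\<And>y. y \<in> cbox 0 (1 :: real ^ 'n) \<Longrightarrow> norm y \<le> N"
    using bounded_cbox[of 0 "1 :: real ^ 'n"] unfolding bounded_iff by blast
  define f where "f = (\<lambda>(y, z). v1 y - v2 z - c * ((y - z) \<bullet> (y - z)))"
  \<comment> \<open>For \<open>norm (y - z) \<ge> M\<close> the penalty is at least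
    \<open>2 * (B1 + B2)\<close>, so \<open>f\<close> does not exceed its value at the
    origin.\<close>
  define M where "M = sqrt (2 * (B1 + B2) / c)"
  have B0: "0 \<le> B1 + B2" using B1[of 0] B2[of 0] by simp
  let ?S = "cbox 0 (1 :: real ^ 'n) \<times> cball (0 :: real ^ 'n) (N + M)"
  have z0: "(0, 0) \<in> ?S"
  proof -
    have "0 \<in> cbox 0 (1 :: real ^ 'n)" by (simp add: mem_box_cart)
    moreover have "0 \<le> M" using B0 c by (simp add: M_def)
    ultimately show ?thesis using N[of 0] by simp
  qed
  have "continuous_on ?S f"
    unfolding f_def case_prod_unfold
    by (intro continuous_intros continuous_on_compose2[OF cv(1)] continuous_on_compose2[OF cv(2)]) auto
  moreover have "compact ?S" by (intro compact_Times compact_cbox compact_cball)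
  ultimately obtain x where x: "x \<in> ?S" "\<forall>x'\<in>?S. f x' \<le> f x"
    using continuous_attains_sup[of ?S f] z0 by blast
  obtain a b where ab: "x = (a, b)" by fastforce
  have max: "f (y, z) \<le> f (a, b)" for y z
  proof -
    obtain k where k: "\<forall>j. k $ j \<in> \<int>" "y + k \<in> cbox 0 1"
      using integer_translate_into_cube by blast
    \<comment> \<open>Translating both variables by the same integer vector preserves
      \<open>f\<close>; this reduces the global maximum to a compact set.\<close>
    have "f (y, z) = f (y + k, z + k)"
      using zn_periodic_add[OF per(1), of k y] zn_periodic_add[OF per(2), of k z] k(1)
      by (simp add: f_def)
    also have "\<dots> \<le> f (a, b)"
    proof (cases "z + k \<in> cball 0 (N + M)")
      case True
      then show ?thesis using x k(2) by (simp add: ab)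
    next
      case False
      then have "N + M < norm (z + k)" by simp
      also have "\<dots> \<le> norm (y + k) + norm (y - z)"
        using norm_triangle_ineq4[of "y + k" "y - z"] by (simp add: algebra_simps)
      finally have "M < norm (y - z)" using N[OF k(2)] by simp
      then have "M\<^sup>2 \<le> (norm (y - z))\<^sup>2" using B0 c by (intro power_mono) (auto simp: M_def)
      then have "2 * (B1 + B2) / c \<le> (y - z) \<bullet> (y - z)"
        using B0 c by (simp add: M_def power2_norm_eq_inner)
      then have "2 * (B1 + B2) \<le> c * ((y - z) \<bullet> (y - z))"
        using c by (simp add: field_simps)
      then have "f (y + k, z + k) \<le> f (0, 0)"
        using B1[of "y + k"] B2[of "z + k"] B1[of 0] B2[of 0]
        by (simp add: f_def abs_le_iff)
      also have "\<dots> \<le> f (a, b)" using x(2) z0 by (simp add: ab)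
      finally show ?thesis .
    qed
    finally show ?thesis .
  qed
  \<comment> \<open>Comparison with (b, b) cancels \<open>v2\<close>, leaving only the Lipschitz
    bound of \<open>v1\<close>.\<close>
  have "c * ((a - b) \<bullet> (a - b)) \<le> v1 a - v1 b"
    using max[of b b] by (simp add: f_def)
  also have "\<dots> \<le> L * norm (a - b)"
    using lipschitz_onD[OF lip, of a b] by (simp add: dist_real_def dist_norm)
  finally have "c * norm (a - b) * norm (a - b) \<le> L * norm (a - b)"
    by (simp add: power2_norm_eq_inner[symmetric] power2_eq_square mult.assoc)
  then have cab: "c * norm (a - b) \<le> L"
    using L by (cases "a = b") auto
  define q where "q = (2 * c) *\<^sub>R (a - b)"
  have "norm q \<le> 2 * L" using cab c by (simp add: q_def)
  moreover have "norm (a - b) < \<delta>"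
  proof -
    have "(L + 1) * norm (a - b) < (L + 1) * \<delta>"
      using cab L \<delta> by (simp add: c_def field_simps)
    then show ?thesis using L by simp
  qed
  ultimately have "\<bar>G a q - G b q\<bar> < e" by (rule \<delta>(2))
  moreover have "G a q - l1 \<le> 0"
    unfolding q_def
  proof (rule viscosity_subsolutionD[OF sub GDERIV_quadratic])
    show "\<forall>\<^sub>F z in nhds a. v1 z - c * ((z - b) \<bullet> (z - b)) \<le> v1 a - c * ((a - b) \<bullet> (a - b))"
      using max[of _ b] by (simp add: f_def)
  qed (intro continuous_intros)
  moreover have "0 \<le> G b ((2 * (- c)) *\<^sub>R (b - a)) - l2"
  proof (rule viscosity_supersolutionD[OF super GDERIV_quadratic])
    show "\<forall>\<^sub>F z in nhds b. v2 b - - c * ((b - a) \<bullet> (b - a)) \<le> v2 z - - c * ((z - a) \<bullet> (z - a))"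
      using max[of a] by (simp add: f_def inner_commute algebra_simps inner_diff_left inner_diff_right)
  qed (intro continuous_intros)
  then have "0 \<le> G b q - l2"
    by (simp add: q_def scaleR_diff_right)
  ultimately show "l2 \<le> l1 + e" by linarith
qed

section \<open>Measurability and size of the gradient\<close>

lemma GDERIV_unique: "GDERIV f y :> a \<Longrightarrow> GDERIV f y :> b \<Longrightarrow> a = b"
  by (rule GDERIV_local_max_unique) auto

lemma gradient_eq: "GDERIV v y :> D \<Longrightarrow> gradient v y = D"
  unfolding gradient_def by (auto intro: GDERIV_unique)

text \<open>The increment is taken along \<open>D\<close> itself, where the linear part is
  \<open>t * (D \<bullet> D)\<close>.\<close>

lemma lipschitz_norm_GDERIV_le:
  fixes v :: "'a::euclidean_space \<Rightarrow> real"
  assumes "L-lipschitz_on UNIV v" "GDERIV v y :> D"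
  shows "norm D \<le> L"
proof (rule field_le_epsilon)
  fix e :: real assume "0 < e"
  then obtain r where r: "0 < r"
    "\<And>z. norm (z - y) < r \<Longrightarrow> norm (v z - v y - (z - y) \<bullet> D) \<le> e * norm (z - y)"
    using assms(2) unfolding gderiv_def has_derivative_at_alt by blast
  show "norm D \<le> L + e"
  proof (cases "D = 0")
    case True
    then show ?thesis using lipschitz_on_nonneg[OF assms(1)] \<open>0 < e\<close> by simp
  next
    case False
    define t where "t = r / (2 * norm D)"
    have t: "0 < t" "t * norm D < r" using r(1) False by (auto simp: t_def)
    have "norm (v (y + t *\<^sub>R D) - v y - t * (D \<bullet> D)) \<le> e * (t * norm D)"
      using r(2)[of "y + t *\<^sub>R D"] t by simp
    moreover have "\<bar>v (y + t *\<^sub>R D) - v y\<bar> \<le> L * (t * norm D)"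
      using lipschitz_onD[OF assms(1), of "y + t *\<^sub>R D" y] t by (simp add: dist_norm)
    ultimately have "t * (D \<bullet> D) \<le> (L + e) * (t * norm D)"
      by (simp add: algebra_simps abs_le_iff)
    then have "(t * norm D) * norm D \<le> (t * norm D) * (L + e)"
      by (simp add: power2_norm_eq_inner[symmetric] power2_eq_square algebra_simps)
    then show ?thesis using t False by simp
  qed
qed

lemma GDERIV_iff_approximable:
  fixes v :: "'a::euclidean_space \<Rightarrow> real"
  assumes dense: "\<forall>X. open X \<longrightarrow> X \<noteq> {} \<longrightarrow> (\<exists>q\<in>Q. q \<in> X)"
  shows "(\<exists>D. GDERIV v y :> D) \<longleftrightarrow>
    (\<forall>k. \<exists>m. \<exists>q\<in>Q. \<forall>z. norm z < 1 / real (Suc m) \<longrightarrow>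
       \<bar>v (y + z) - v y - z \<bullet> q\<bar> \<le> norm z / real (Suc k))"
    (is "?L \<longleftrightarrow> ?R")
proof
  assume ?L
  then obtain D where D: "GDERIV v y :> D" by blast
  show ?R
  proof
    fix k
    define e where "e = 1 / real (Suc k) / 2"
    have e: "0 < e" by (simp add: e_def)
    then obtain r where r: "0 < r"
      "\<And>z. norm (z - y) < r \<Longrightarrow> norm (v z - v y - (z - y) \<bullet> D) \<le> e * norm (z - y)"
      using D unfolding gderiv_def has_derivative_at_alt by blast
    obtain m where m: "1 / real (Suc m) < r" using nat_approx_posE[OF r(1)] .
    obtain q where q: "q \<in> Q" "q \<in> ball D e" using dense[rule_format, of "ball D e"] e by auto
    have "\<bar>v (y + z) - v y - z \<bullet> q\<bar> \<le> norm z / real (Suc k)" if "norm z < 1 / real (Suc m)" for z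
    proof -
      have "\<bar>v (y + z) - v y - z \<bullet> D\<bar> \<le> e * norm z" using r(2)[of "y + z"] that m by simp
      moreover have "\<bar>z \<bullet> (D - q)\<bar> \<le> e * norm z"
        using Cauchy_Schwarz_ineq2[of z "D - q"] q(2)
        by (smt (verit) dist_norm mem_ball mult.commute mult_left_mono norm_ge_zero)
      ultimately have "\<bar>v (y + z) - v y - z \<bullet> q\<bar> \<le> e * norm z + e * norm z"
        unfolding inner_diff_right by arith
      also have "e * norm z + e * norm z = (e + e) * norm z" by (rule distrib_right[symmetric])
      also have "e + e = 1 / real (Suc k)" unfolding e_def by (rule field_sum_of_halves)
      also have "1 / real (Suc k) * norm z = norm z / real (Suc k)" by simp
      finally show ?thesis .
    qed
    then show "\<exists>m. \<exists>q\<in>Q. \<forall>z. norm z < 1 / real (Suc m) \<longrightarrow>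
       \<bar>v (y + z) - v y - z \<bullet> q\<bar> \<le> norm z / real (Suc k)"
      using q(1) by blast
  qed
next
  assume ?R
  then obtain m q where mq: "\<And>k z. norm z < 1 / real (Suc (m k)) \<Longrightarrow>
      \<bar>v (y + z) - v y - z \<bullet> q k\<bar> \<le> norm z / real (Suc k)"
    by metis
  have close: "norm (q k - q j) \<le> 1 / real (Suc k) + 1 / real (Suc j)" for k j
  proof (cases "q k = q j")
    case False
    define w where "w = q k - q j"
    have w: "0 < norm w" using False by (simp add: w_def)
    \<comment> \<open>The two approximations are compared along \<open>w\<close>, their difference,
      scaled into both balls.\<close>
    define t where "t = min (1 / real (Suc (m k))) (1 / real (Suc (m j))) / (2 * norm w)"
    have t: "0 < t" "t * norm w < 1 / real (Suc (m k))" "t * norm w < 1 / real (Suc (m j))"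
      using w by (auto simp: t_def min_def field_simps)
    have "\<bar>v (y + t *\<^sub>R w) - v y - t * (w \<bullet> q k)\<bar> \<le> t * norm w / real (Suc k)"
         "\<bar>v (y + t *\<^sub>R w) - v y - t * (w \<bullet> q j)\<bar> \<le> t * norm w / real (Suc j)"
      using mq[of "t *\<^sub>R w" k] mq[of "t *\<^sub>R w" j] t by simp_all
    then have "t * (w \<bullet> q k) - t * (w \<bullet> q j) \<le> t * norm w / real (Suc k) + t * norm w / real (Suc j)"
      by arith
    also have "t * (w \<bullet> q k) - t * (w \<bullet> q j) = (t * norm w) * norm w"
      by (simp add: w_def right_diff_distrib[symmetric] inner_diff_right[symmetric]
        power2_norm_eq_inner[symmetric] power2_eq_square)
    also have "t * norm w / real (Suc k) + t * norm w / real (Suc j) =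
        (t * norm w) * (1 / real (Suc k) + 1 / real (Suc j))" by (simp add: algebra_simps)
    finally show ?thesis using t w by (simp add: w_def)
  qed simp
  have "Cauchy q"
  proof (rule metric_CauchyI)
    fix e :: real assume "0 < e"
    then obtain N where N: "1 / real (Suc N) < e / 2" using nat_approx_posE[of "e / 2"] by auto
    have "dist (q k) (q j) < e" if "N \<le> k" "N \<le> j" for k j
    proof -
      have "1 / real (Suc k) \<le> 1 / real (Suc N)" "1 / real (Suc j) \<le> 1 / real (Suc N)"
        using that by (auto intro!: divide_left_mono)
      then show ?thesis using close[of k j] N by (simp add: dist_norm)
    qed
    then show "\<exists>M. \<forall>m\<ge>M. \<forall>n\<ge>M. dist (q m) (q n) < e" by blast
  qed
  then obtain D where D: "q \<longlonglongrightarrow> D" using Cauchy_convergent convergent_def by blast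
  have qD: "norm (q k - D) \<le> 1 / real (Suc k)" for k
  proof (rule LIMSEQ_le)
    show "(\<lambda>j. norm (q k - q j)) \<longlonglongrightarrow> norm (q k - D)" by (intro tendsto_intros D)
    have "(\<lambda>j. 1 / real (Suc k) + inverse (real (Suc j))) \<longlonglongrightarrow> 1 / real (Suc k) + 0"
      by (intro tendsto_add tendsto_const LIMSEQ_inverse_real_of_nat)
    then show "(\<lambda>j. 1 / real (Suc k) + 1 / real (Suc j)) \<longlonglongrightarrow> 1 / real (Suc k)"
      by (simp add: inverse_eq_divide)
  qed (use close in blast)
  have "GDERIV v y :> D"
    unfolding gderiv_def has_derivative_at_alt
  proof (intro conjI allI impI bounded_linear_inner_left)
    fix e :: real assume "0 < e"
    then obtain k where k: "1 / real (Suc k) < e / 2" using nat_approx_posE[of "e / 2"] by auto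
    have "norm (v z - v y - (z - y) \<bullet> D) \<le> e * norm (z - y)"
      if "norm (z - y) < 1 / real (Suc (m k))" for z
    proof -
      have "\<bar>v z - v y - (z - y) \<bullet> q k\<bar> \<le> norm (z - y) * (1 / real (Suc k))"
        using mq[OF that] by simp
      moreover have "\<bar>(z - y) \<bullet> (q k - D)\<bar> \<le> norm (z - y) * (1 / real (Suc k))"
        using Cauchy_Schwarz_ineq2[of "z - y" "q k - D"] mult_left_mono[OF qD[of k] norm_ge_zero[of "z - y"]]
        by linarith
      ultimately have "\<bar>v z - v y - (z - y) \<bullet> D\<bar> \<le>
          norm (z - y) * (1 / real (Suc k)) + norm (z - y) * (1 / real (Suc k))"
        unfolding inner_diff_right by arith
      also have "\<dots> = norm (z - y) * (1 / real (Suc k) + 1 / real (Suc k))"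
        by (rule distrib_left[symmetric])
      also have "\<dots> \<le> norm (z - y) * e" using k by (intro mult_left_mono) auto
      finally show ?thesis by (simp add: mult.commute)
    qed
    then show "\<exists>d>0. \<forall>z. norm (z - y) < d \<longrightarrow> norm (v z - v y - (z - y) \<bullet> D) \<le> e * norm (z - y)"
      by (intro exI[of _ "1 / real (Suc (m k))"]) auto
  qed
  then show ?L by blast
qed

text \<open>The uncountable quantifier over \<open>z\<close> is an intersection of closed sets,
  hence closed; the other quantifiers are countable.\<close>

lemma sets_borel_differentiable_points:
  fixes v :: "'a::euclidean_space \<Rightarrow> real"
  assumes v: "continuous_on UNIV v"
  shows "{y. \<exists>D. GDERIV v y :> D} \<in> sets borel"
proof -
  obtain Q :: "'a set" where Q: "countable Q" "\<forall>X. open X \<longrightarrow> X \<noteq> {} \<longrightarrow> (\<exists>q\<in>Q. q \<in> X)"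
    using countable_dense_setE by blast
  define E where "E k m q = {y. \<forall>z. norm z < 1 / real (Suc m) \<longrightarrow>
       \<bar>v (y + z) - v y - z \<bullet> q\<bar> \<le> norm z / real (Suc k)}" for k m q
  have "closed (E k m q)" for k m q
  proof -
    have "closed {y. norm z < 1 / real (Suc m) \<longrightarrow>
       \<bar>v (y + z) - v y - z \<bullet> q\<bar> \<le> norm z / real (Suc k)}" for z
    proof (intro closed_Collect_imp closed_Collect_le)
      show "continuous_on UNIV (\<lambda>y. \<bar>v (y + z) - v y - z \<bullet> q\<bar>)"
        by (intro continuous_intros continuous_on_compose2[OF v]) auto
    qed (auto intro: continuous_intros)
    then show ?thesis unfolding E_def by (intro closed_Collect_all) blast
  qed
  then have "(\<Union>q\<in>Q. E k m q) \<in> sets borel" for k m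
    using Q(1) by (intro sets.countable_UN' borel_closed) auto
  then have "(\<Inter>k. \<Union>m. \<Union>q\<in>Q. E k m q) \<in> sets borel"
    by (intro sets.countable_INT sets.countable_UN) auto
  also have "(\<Inter>k. \<Union>m. \<Union>q\<in>Q. E k m q) = {y. \<exists>D. GDERIV v y :> D}"
    by (simp add: GDERIV_iff_approximable[OF Q(2)] E_def set_eq_iff)
  finally show ?thesis .
qed

lemma borel_measurable_gradient:
  fixes v :: "'a::euclidean_space \<Rightarrow> real"
  assumes v: "continuous_on UNIV v"
  shows "gradient v \<in> borel_measurable borel"
proof (rule borel_measurable_LIMSEQ_metric)
  let ?A = "{y. \<exists>D. GDERIV v y :> D}"
  \<comment> \<open>Difference quotients along the basis; the indicator makes the limit 0 off
    \<open>?A\<close>, matching the default value in \<open>gradient\<close>.\<close>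
  define f where "f n y = indicat_real ?A y *\<^sub>R
    (\<Sum>b\<in>Basis. ((v (y + (1 / real (Suc n)) *\<^sub>R b) - v y) * real (Suc n)) *\<^sub>R b)" for n y
  have [measurable]: "?A \<in> sets borel" by (rule sets_borel_differentiable_points[OF v])
  have [measurable]: "(\<lambda>y. v (y + c)) \<in> borel_measurable borel" for c
    by (intro borel_measurable_continuous_onI continuous_on_compose2[OF v] continuous_intros) auto
  have [measurable]: "v \<in> borel_measurable borel"
    using v by (rule borel_measurable_continuous_onI)
  show "f n \<in> borel_measurable borel" for n
    unfolding f_def by measurable
  fix y
  show "(\<lambda>n. f n y) \<longlonglongrightarrow> gradient v y"
  proof (cases "y \<in> ?A")
    case True
    then obtain D where D: "GDERIV v y :> D" by blast
    have "(\<lambda>n. (v (y + (1 / real (Suc n)) *\<^sub>R b) - v y) * real (Suc n)) \<longlonglongrightarrow> b \<bullet> D" if "b \<in> Basis" for b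
    proof (rule LIMSEQ_I)
      fix e :: real assume "0 < e"
      then obtain r where r: "0 < r"
        "\<And>z. norm (z - y) < r \<Longrightarrow> norm (v z - v y - (z - y) \<bullet> D) \<le> e / 2 * norm (z - y)"
        using D half_gt_zero unfolding gderiv_def has_derivative_at_alt by blast
      obtain N where N: "1 / real (Suc N) < r" using nat_approx_posE[OF r(1)] .
      have "norm ((v (y + (1 / real (Suc n)) *\<^sub>R b) - v y) * real (Suc n) - b \<bullet> D) < e" if "N \<le> n" for n
      proof -
        define t where "t = 1 / real (Suc n)"
        have t: "0 < t" "t < r" "real (Suc n) = 1 / t"
          using that N divide_left_mono[of "real (Suc N)" "real (Suc n)" 1] by (auto simp: t_def)
        have "\<bar>v (y + t *\<^sub>R b) - v y - t * (b \<bullet> D)\<bar> \<le> e / 2 * t"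
          using r(2)[of "y + t *\<^sub>R b"] t \<open>b \<in> Basis\<close> by simp
        moreover have "(v (y + t *\<^sub>R b) - v y) * (1 / t) - b \<bullet> D = (v (y + t *\<^sub>R b) - v y - t * (b \<bullet> D)) / t"
          using t by (simp add: field_simps)
        ultimately have "\<bar>(v (y + t *\<^sub>R b) - v y) * (1 / t) - b \<bullet> D\<bar> \<le> e / 2"
          using t by (simp add: divide_le_eq)
        then show ?thesis using \<open>0 < e\<close> unfolding t_def[symmetric] t(3) by simp
      qed
      then show "\<exists>N. \<forall>n\<ge>N. norm ((v (y + (1 / real (Suc n)) *\<^sub>R b) - v y) * real (Suc n) - b \<bullet> D) < e"
        by blast
    qed
    then have "(\<lambda>n. f n y) \<longlonglongrightarrow> indicat_real ?A y *\<^sub>R (\<Sum>b\<in>Basis. (b \<bullet> D) *\<^sub>R b)"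
      unfolding f_def by (intro tendsto_intros)
    also have "indicat_real ?A y *\<^sub>R (\<Sum>b\<in>Basis. (b \<bullet> D) *\<^sub>R b) = gradient v y"
      using True euclidean_representation[of D]
      by (simp add: gradient_eq[OF D] inner_commute[of D])
    finally show ?thesis .
  qed (auto simp: f_def gradient_def)
qed

text \<open>The bound holds at every point, the default value 0 included; \<open>esssup_I\<close>
  also asks for measurability, the purpose of the preceding lemmas.\<close>

lemma ess_sup_norm_gradient_le:
  fixes v :: "'a::euclidean_space \<Rightarrow> real"
  assumes "L-lipschitz_on UNIV v"
  shows "ess_sup_norm (gradient v) \<le> ereal L"
  unfolding ess_sup_norm_def
proof (rule esssup_I)
  have [measurable]: "gradient v \<in> borel_measurable borel"
    by (intro borel_measurable_gradient lipschitz_on_continuous_on[OF assms])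
  have "(\<lambda>y. ereal (norm (gradient v y))) \<in> borel_measurable lborel" by measurable
  then show "(\<lambda>y. ereal (norm (gradient v y))) \<in> borel_measurable lebesgue"
    by (rule measurable_completion)
  have "norm (gradient v y) \<le> L" for y
    using lipschitz_norm_GDERIV_le[OF assms, of y] lipschitz_on_nonneg[OF assms]
    by (cases "\<exists>D. GDERIV v y :> D") (auto simp: gradient_eq, simp add: gradient_def)
  then show "AE y in lebesgue. ereal (norm (gradient v y)) \<le> ereal L" by simp
qed

section \<open>The structural assumptions\<close>

text \<open>The source of L_R: \<open>C\<close> comes from boundedness on bounded sets,
  \<open>K\<close> from coercivity, and both are chosen before \<open>x\<close>, \<open>r\<close>
  and \<open>p\<close>.\<close>

lemma assumptions_S_bounds:
  fixes h :: "real ^ 'n \<Rightarrow> real ^ 'n \<Rightarrow> real ^ 'm \<Rightarrow> real ^ 'n \<Rightarrow> real"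
  assumes h: "assumptions_S h" and "0 < R"
  shows "\<exists>C K. 0 < K \<and> (\<forall>x y r p. norm r + norm p \<le> R \<longrightarrow>
    \<bar>h x y r p\<bar> \<le> C \<and> (\<forall>q. h x y r (p + q) \<le> C \<longrightarrow> norm q \<le> K))"
proof -
  \<comment> \<open>The ball is open, so radius \<open>R + 1\<close> is taken to include
    \<open>norm p = R\<close>.\<close>
  let ?D = "UNIV \<times> UNIV \<times> {r. \<forall>k. r $ k \<in> {- (R + 1)..R + 1}} \<times> ball 0 (R + 1)"
  have BUC: "\<forall>R>0. BUC_on (UNIV \<times> UNIV \<times> {r. \<forall>k. r $ k \<in> {- R..R}} \<times> ball 0 R)
      (\<lambda>(x, y, r, p). h x y r p)"
    using h unfolding assumptions_S_def by blast
  have "BUC_on ?D (\<lambda>(x, y, r, p). h x y r p)"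
    by (rule mp[OF spec[OF BUC]]) (use \<open>0 < R\<close> in simp)
  then obtain C where C: "\<forall>t\<in>?D. norm ((\<lambda>(x, y, r, p). h x y r p) t) \<le> C"
    unfolding BUC_on_def bounded_iff by blast
  have bound: "\<bar>h x y r p\<bar> \<le> C" if "norm r + norm p \<le> R" for x y r p
  proof -
    have "norm p < R + 1" using that norm_ge_zero[of r] by linarith
    moreover have "- (R + 1) \<le> r $ k \<and> r $ k \<le> R + 1" for k
      using component_le_norm_cart[of r k] that norm_ge_zero[of p] by linarith
    ultimately have "(x, y, r, p) \<in> ?D" by simp
    then show ?thesis using C by fastforce
  qed
  \<comment> \<open>Level \<open>C + 1\<close> rather than \<open>C\<close>, so that a value at most
    \<open>C\<close> forces \<open>norm (p + q) < b\<close>.\<close>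
  have "\<forall>\<^sub>F p in at_infinity. \<forall>x y r. C + 1 \<le> h x y r p"
    using h unfolding assumptions_S_def by blast
  then obtain b where b: "\<And>p x y r. b \<le> norm p \<Longrightarrow> C + 1 \<le> h x y r p"
    unfolding eventually_at_infinity by blast
  have "norm q \<le> R + \<bar>b\<bar>" if "norm r + norm p \<le> R" "h x y r (p + q) \<le> C" for x y r p q
  proof -
    have "norm (p + q) < b" using b[of "p + q" x y r] that(2) by force
    moreover have "norm p \<le> R" using that(1) norm_ge_zero[of r] by linarith
    ultimately show ?thesis using norm_triangle_ineq4[of "p + q" p] by simp
  qed
  then show ?thesis
    using bound \<open>0 < R\<close> by (intro exI[of _ C] exI[of _ "R + \<bar>b\<bar>"]) auto
qed

text \<open>The modulus is used with equal \<open>x\<close> arguments; for bounded \<open>q\<close>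
  the factor \<open>1 + norm (p + q)\<close> is bounded, and continuity of \<omega> at 0
  finishes.\<close>

lemma assumptions_S_unif:
  fixes h :: "real ^ 'n \<Rightarrow> real ^ 'n \<Rightarrow> real ^ 'm \<Rightarrow> real ^ 'n \<Rightarrow> real"
  assumes h: "assumptions_S h" and "0 < e"
  shows "\<exists>\<delta>>0. \<forall>y z q. norm q \<le> R \<longrightarrow> norm (y - z) < \<delta> \<longrightarrow>
    \<bar>h x y r (p + q) - h x z r (p + q)\<bar> < e"
proof -
  obtain \<omega> where \<omega>: "modulus_of_continuity \<omega>"
    "\<And>x1 x2 y1 y2 p r. \<bar>h x1 y1 r p - h x2 y2 r p\<bar>
             \<le> \<omega> ((1 + norm p) * (norm (x1 - x2) + norm (y1 - y2)))"
    using h unfolding assumptions_S_def by blast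
  then have cont: "continuous_on {0..} \<omega>" and \<omega>0: "\<omega> 0 = 0"
    by (auto simp: modulus_of_continuity_def)
  obtain \<eta> where \<eta>: "0 < \<eta>" "\<forall>t\<in>{0..}. dist t 0 < \<eta> \<longrightarrow> dist (\<omega> t) 0 < e"
    using bspec[OF cont[unfolded continuous_on_iff], of 0] \<open>0 < e\<close> \<omega>0 by auto
  have small: "\<omega> t < e" if "0 \<le> t" "t < \<eta>" for t
    using \<eta>(2)[rule_format, of t] that by (simp add: dist_real_def abs_less_iff)
  define \<delta> where "\<delta> = \<eta> / (1 + norm p + \<bar>R\<bar>)"
  have P: "0 < 1 + norm p + \<bar>R\<bar>" by (simp add: add_pos_nonneg)
  have "\<bar>h x y r (p + q) - h x z r (p + q)\<bar> < e" if "norm q \<le> R" "norm (y - z) < \<delta>" for y z q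
  proof -
    have "1 + norm (p + q) \<le> 1 + norm p + \<bar>R\<bar>" using norm_triangle_ineq[of p q] that(1) by simp
    then have "(1 + norm (p + q)) * norm (y - z) \<le> (1 + norm p + \<bar>R\<bar>) * norm (y - z)"
      by (rule mult_right_mono) simp
    also have "\<dots> < \<eta>" using that(2) P by (simp add: \<delta>_def field_simps)
    finally have "\<omega> ((1 + norm (p + q)) * norm (y - z)) < e"
      by (intro small) simp_all
    then show ?thesis using \<omega>(2)[of x y r "p + q" x z] by simp
  qed
  then show ?thesis using \<eta> P by (intro exI[of _ \<delta>]) (auto simp: \<delta>_def)
qed

lemma lipschitz_cell_solution_exists:
  fixes h :: "real ^ 'n \<Rightarrow> real ^ 'n \<Rightarrow> real ^ 'm \<Rightarrow> real ^ 'n \<Rightarrow> real"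
  assumes cont: "continuous_on UNIV (\<lambda>(x, y, r, p). h x y r p)" and h: "assumptions_S h"
  shows "\<exists>l v. lipschitz_cell_solution h x r p l v"
proof -
  have "0 < norm r + norm p + 1" by (simp add: add_nonneg_pos)
  from assumptions_S_bounds[OF h this] obtain C K where
    "0 < K" and CK: "\<forall>x y r' p'. norm r' + norm p' \<le> norm r + norm p + 1 \<longrightarrow>
      \<bar>h x y r' p'\<bar> \<le> C \<and> (\<forall>q. h x y r' (p' + q) \<le> C \<longrightarrow> norm q \<le> K)"
    by (elim exE conjE) (rule that)
  have CK: "\<bar>h x y r p\<bar> \<le> C" "h x y r (p + q) \<le> C \<longrightarrow> norm q \<le> K" for y q
    using CK[rule_format, of r p x y] by auto
  have "continuous_on UNIV (\<lambda>t. (case (x, fst t, r, p + snd t) of (x, y, r, p) \<Rightarrow> h x y r p))"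
    by (intro continuous_on_compose2[OF cont] continuous_intros) auto
  then have "continuous_on UNIV (\<lambda>(y, q). h x y r (p + q))" by (simp add: case_prod_unfold)
  moreover have "zn_periodic (\<lambda>y. h x y r (p + q))" for q
    using h unfolding assumptions_S_def by blast
  moreover have "\<bar>h x y r (p + 0)\<bar> \<le> C" for y using CK(1) by simp
  moreover have "\<forall>y q. h x y r (p + q) \<le> C \<longrightarrow> norm q \<le> K" using CK(2) by simp
  ultimately obtain l v where "zn_periodic v" "K-lipschitz_on UNIV v"
    "viscosity_solution (\<lambda>y q. h x y r (p + q) - l) v"
    using cell_solution_exists[of "\<lambda>y q. h x y r (p + q)" C K] by blast
  then show ?thesis unfolding lipschitz_cell_solution_def by blast
qed

lemma lipschitz_cell_solution_unique:
  fixes h :: "real ^ 'n \<Rightarrow> real ^ 'n \<Rightarrow> real ^ 'm \<Rightarrow> real ^ 'n \<Rightarrow> real"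
  assumes h: "assumptions_S h"
    and v1: "lipschitz_cell_solution h x r p l1 v1" and v2: "lipschitz_cell_solution h x r p l2 v2"
  shows "l1 = l2"
proof -
  have "l2 \<le> l1" if v1: "lipschitz_cell_solution h x r p l1 v1"
    and v2: "lipschitz_cell_solution h x r p l2 v2" for l1 l2 v1 v2
  proof -
    obtain L where "L-lipschitz_on UNIV v1"
      using v1 unfolding lipschitz_cell_solution_def by blast
    then show ?thesis
      using cell_comparison[of "\<lambda>y q. h x y r (p + q)" v1 v2 L l1 l2]
        assumptions_S_unif[OF h] v1 v2
      unfolding lipschitz_cell_solution_def viscosity_solution_def by blast
  qed
  then show ?thesis using v1 v2 by (intro order_antisym) blast+
qed

theorem proposition4p1:
  fixes H :: "'m::finite \<Rightarrow> real ^ 'n \<Rightarrow> real ^ 'n \<Rightarrow> real ^ 'm \<Rightarrow> real ^ 'n \<Rightarrow> real"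
  assumes "\<And>j. continuous_on UNIV (\<lambda>(x, y, r, p). H j x y r p)"
    and "\<And>j. assumptions_S (H j)"
  shows "\<forall>i. (\<forall>x r p. \<exists>!l. \<exists>v. lipschitz_cell_solution (H i) x r p l v) \<and>
     (\<exists>v. (\<forall>x r p. \<exists>l. lipschitz_cell_solution (H i) x r p l (v x r p)) \<and>
        (\<forall>R>0. \<exists>L>0.
           (SUP (x, r, p) \<in> {(x, r, p). norm r + norm p \<le> R}.
              ess_sup_norm (gradient (v x r p))) \<le> ereal L))"
proof (intro allI conjI)
  fix i x r p
  show "\<exists>!l. \<exists>v. lipschitz_cell_solution (H i) x r p l v"
  proof (rule ex_ex1I)
    show "\<exists>l v. lipschitz_cell_solution (H i) x r p l v"
      by (rule lipschitz_cell_solution_exists[OF assms])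
  qed (auto intro: lipschitz_cell_solution_unique[OF assms(2)])
next
  fix i
  define v where "v x r p = (SOME v. \<exists>l. lipschitz_cell_solution (H i) x r p l v)" for x r p
  have v: "\<exists>l. lipschitz_cell_solution (H i) x r p l (v x r p)" for x r p
  proof -
    have "\<exists>v l. lipschitz_cell_solution (H i) x r p l v"
      using lipschitz_cell_solution_exists[OF assms] by blast
    then show ?thesis unfolding v_def by (rule someI_ex)
  qed
  have "\<exists>L>0. (SUP (x, r, p) \<in> {(x, r, p). norm r + norm p \<le> R}.
      ess_sup_norm (gradient (v x r p))) \<le> ereal L" if "0 < R" for R
  proof -
    obtain C K where CK: "0 < K" "\<forall>x y r p. norm r + norm p \<le> R \<longrightarrow>
        \<bar>H i x y r p\<bar> \<le> C \<and> (\<forall>q. H i x y r (p + q) \<le> C \<longrightarrow> norm q \<le> K)"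
      using assumptions_S_bounds[OF assms(2) \<open>0 < R\<close>, of i] by (elim exE conjE) (rule that)
    have "ess_sup_norm (gradient (v x r p)) \<le> ereal K" if "norm r + norm p \<le> R" for x r p
    proof (rule ess_sup_norm_gradient_le)
      obtain l where "lipschitz_cell_solution (H i) x r p l (v x r p)" using v by blast
      moreover have "\<bar>H i x y r (p + 0)\<bar> \<le> C" for y using CK(2) that by simp
      moreover have "\<forall>y q. H i x y r (p + q) \<le> C \<longrightarrow> norm q \<le> K" using CK(2) that by blast
      ultimately show "K-lipschitz_on UNIV (v x r p)"
        using cell_solution_lipschitz[of "\<lambda>y q. H i x y r (p + q)" C K "v x r p" l]
        unfolding lipschitz_cell_solution_def by blast
    qed
    then show ?thesis using CK(1) by (intro exI[of _ K] conjI SUP_least) auto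
  qed
  then show "\<exists>v. (\<forall>x r p. \<exists>l. lipschitz_cell_solution (H i) x r p l (v x r p)) \<and>
        (\<forall>R>0. \<exists>L>0. (SUP (x, r, p) \<in> {(x, r, p). norm r + norm p \<le> R}.
              ess_sup_norm (gradient (v x r p))) \<le> ereal L)"
    using v by blast
qed

end
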